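(* Let $\mathfrak h$ be an Abelian subalgebra of $\mathfrak{sl}(n,\mathbb R)$ and set $\mathfrak B_{\mathfrak h}:=\mathbb R\,\mathbb I_{\mathbb R^n}\oplus\mathfrak h$, where $\mathbb I_{\mathbb R^n}$ is the $n\times n$ identity matrix. The following are equivalent: (a) $\mathfrak h$ is a Cartan subalgebra of $\mathfrak{sl}(n,\mathbb R)$; (b) $\mathfrak B_{\mathfrak h}$ is the algebra $\mathbb R[M]$ of polynomials of some nonderogatory $n\times n$ real matrix $M$ with $n$ distinct (real or complex) eigenvalues; (c) the Lie algebra $\mathfrak B_{\mathfrak h}\ltimes\mathbb R^n$ is the direct sum $\mathfrak{aff}(\mathbb C)\oplus\dots\oplus\mathfrak{aff}(\mathbb C)\oplus\mathfrak{aff}(\mathbb R)\oplus\dots\oplus\mathfrak{aff}(\mathbb R)$ of $p$ copies of the Lie algebra $\mathfrak{aff}(\mathbb C)$ and $q$ copies of $\mathfrak{aff}(\mathbb R)$, where $p$ and $q$ are the respective dimensions of the toroidal and the vector parts of $\mathfrak h$.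
   Context: A Cartan subalgebra of a Lie algebra is a nilpotent subalgebra equal to its own normalizer. A square matrix is nonderogatory if its characteristic and minimal polynomials coincide. $\mathbb R[M]$ is the algebra of all real polynomials in $M$. For an Abelian Lie algebra $\mathfrak B$ of $n\times n$ real matrices, $\mathfrak B\ltimes\mathbb R^n$ is the vector space $\mathfrak B\oplus\mathbb R^n$ with Lie bracket $[a,b]=[x,y]=0$, $[a,x]=ax$ for $a,b\in\mathfrak B$, $x,y\in\mathbb R^n$. $\mathfrak{aff}(\mathbb R)$ is the Lie algebra of the group of affine motions of the real line: it has a basis $(e_1,e_2)$ with $[e_1,e_2]=e_2$. $\mathfrak{aff}(\mathbb C)$ is the Lie algebra of the group of affine motions of the complex line, regarded as a 4-dimensional real Lie algebra: it has a basis $(e_1,\dots,e_4)$ with nonzero brackets $[e_1,e_3]=e_3$, $[e_1,e_4]=e_4$, $[e_2,e_3]=e_4$, $[e_2,e_4]=-e_3$. A Cartan subalgebra $\mathfrak h$ of a semisimple Lie algebra $\mathcal G$ splits as a direct sum $\mathfrak h=\mathfrak h^+\oplus\mathfrak h^-$ of two subalgebras, called its toroidal part $\mathfrak h^+$ and its vector part $\mathfrak h^-$: $\mathfrak h^+$ consists of the elements of $\mathfrak h$ whose adjoint operator on $\mathcal G$ has only purely imaginary eigenvalues, and $\mathfrak h^-$ of the elements of $\mathfrak h$ whose adjoint operator has only real eigenvalues. Here $\mathcal G=\mathfrak{sl}(n,\mathbb R)$.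
   Formalization: In (c) the printed "q = dimension of the vector part" is false (e.g. n=2, diagonal h: two copies of aff(R), vector part of dimension 1); it is corrected to p + q = dim(vector part) + 1, with p = dim(toroidal part) unchanged. *)

theory Defs
  imports "HOL-Analysis.Analysis" "HOL-Computational_Algebra.Polynomial"
begin

section \<open>Lie algebras inside real vector spaces\<close>

text \<open>
  A real Lie algebra is given by a carrier, which is a linear subspace of a type of class
  \<open>real_vector\<close>, together with a bracket on that type.
\<close>

definition lie_subalgebra ::
    "'a::real_vector set \<Rightarrow> 'a set \<Rightarrow> ('a \<Rightarrow> 'a \<Rightarrow> 'a) \<Rightarrow> bool" where
  "lie_subalgebra H G br \<longleftrightarrow> subspace H \<and> H \<subseteq> G \<and> (\<forall>x\<in>H. \<forall>y\<in>H. br x y \<in> H)"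

definition lie_ideal ::
    "'a::real_vector set \<Rightarrow> 'a set \<Rightarrow> ('a \<Rightarrow> 'a \<Rightarrow> 'a) \<Rightarrow> bool" where
  "lie_ideal I G br \<longleftrightarrow> subspace I \<and> I \<subseteq> G \<and> (\<forall>x\<in>G. \<forall>y\<in>I. br x y \<in> I)"

definition lie_abelian :: "'a::real_vector set \<Rightarrow> ('a \<Rightarrow> 'a \<Rightarrow> 'a) \<Rightarrow> bool" where
  "lie_abelian H br \<longleftrightarrow> (\<forall>x\<in>H. \<forall>y\<in>H. br x y = 0)"

primrec lower_central_series ::
    "'a::real_vector set \<Rightarrow> ('a \<Rightarrow> 'a \<Rightarrow> 'a) \<Rightarrow> nat \<Rightarrow> 'a set" where
  "lower_central_series H br 0 = H"
| "lower_central_series H br (Suc k) =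
     span {br x y |x y. x \<in> H \<and> y \<in> lower_central_series H br k}"

definition lie_nilpotent :: "'a::real_vector set \<Rightarrow> ('a \<Rightarrow> 'a \<Rightarrow> 'a) \<Rightarrow> bool" where
  "lie_nilpotent H br \<longleftrightarrow> (\<exists>k. lower_central_series H br k = {0})"

definition lie_normalizer ::
    "'a::real_vector set \<Rightarrow> 'a set \<Rightarrow> ('a \<Rightarrow> 'a \<Rightarrow> 'a) \<Rightarrow> 'a set" where
  "lie_normalizer H G br = {x \<in> G. \<forall>y\<in>H. br x y \<in> H}"

definition cartan_subalgebra ::
    "'a::real_vector set \<Rightarrow> 'a set \<Rightarrow> ('a \<Rightarrow> 'a \<Rightarrow> 'a) \<Rightarrow> bool" where
  "cartan_subalgebra H G br \<longleftrightarrow>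
     lie_subalgebra H G br \<and> lie_nilpotent H br \<and> lie_normalizer H G br = H"

text \<open>
  Requiring \<^term>\<open>f\<close> to be linear on the whole type is no restriction: a linear map on the
  subspace \<^term>\<open>A\<close> extends to one on the ambient space.
\<close>

definition lie_isomorphic ::
    "'a::real_vector set \<Rightarrow> ('a \<Rightarrow> 'a \<Rightarrow> 'a) \<Rightarrow> 'b::real_vector set \<Rightarrow> ('b \<Rightarrow> 'b \<Rightarrow> 'b) \<Rightarrow> bool"
  where
  "lie_isomorphic A brA B brB \<longleftrightarrow>
     (\<exists>f. linear f \<and> bij_betw f A B \<and> (\<forall>x\<in>A. \<forall>y\<in>A. f (brA x y) = brB (f x) (f y)))"

text \<open>
  Direct sum of Lie algebras, in internal form. Distinct summands commute automatically, since
  their brackets lie in the (trivial) intersection of the two ideals.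
\<close>

definition lie_direct_sum ::
    "'a::real_vector set \<Rightarrow> ('a \<Rightarrow> 'a \<Rightarrow> 'a) \<Rightarrow> 'i set \<Rightarrow> ('i \<Rightarrow> 'a set) \<Rightarrow> bool" where
  "lie_direct_sum L br I A \<longleftrightarrow>
     finite I \<and> (\<forall>i\<in>I. lie_ideal (A i) L br) \<and>
     (\<forall>x\<in>L. \<exists>!f. f \<in> (\<Pi>\<^sub>E i\<in>I. A i) \<and> x = (\<Sum>i\<in>I. f i))"

text \<open>
  The eigenvalues, in the complex numbers, of a real linear operator \<^term>\<open>T\<close> on a real vector
  space \<^term>\<open>V\<close>, i.e. the eigenvalues of its complexification: the equations say
  \<open>T (u + \<i> v) = z (u + \<i> v)\<close> with \<open>u + \<i> v \<noteq> 0\<close>.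
\<close>

definition complex_eigenvalues :: "'a::real_vector set \<Rightarrow> ('a \<Rightarrow> 'a) \<Rightarrow> complex set" where
  "complex_eigenvalues V T =
     {z. \<exists>u\<in>V. \<exists>v\<in>V. (u \<noteq> 0 \<or> v \<noteq> 0) \<and>
           T u = Re z *\<^sub>R u - Im z *\<^sub>R v \<and> T v = Im z *\<^sub>R u + Re z *\<^sub>R v}"

text \<open>Zero counts as a purely imaginary number (and as a real one).\<close>

definition toroidal_part ::
    "'a::real_vector set \<Rightarrow> 'a set \<Rightarrow> ('a \<Rightarrow> 'a \<Rightarrow> 'a) \<Rightarrow> 'a set" where
  "toroidal_part H G br = {x \<in> H. \<forall>z \<in> complex_eigenvalues G (br x). Re z = 0}"

definition vector_part ::
    "'a::real_vector set \<Rightarrow> 'a set \<Rightarrow> ('a \<Rightarrow> 'a \<Rightarrow> 'a) \<Rightarrow> 'a set" where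
  "vector_part H G br = {x \<in> H. \<forall>z \<in> complex_eigenvalues G (br x). Im z = 0}"


section \<open>Matrices\<close>

definition mat_bracket :: "real^'n^'n \<Rightarrow> real^'n^'n \<Rightarrow> real^'n^'n" where
  "mat_bracket X Y = X ** Y - Y ** X"

definition sl :: "(real^'n^'n) set" where
  "sl = {X. trace X = 0}"

text \<open>The instance of class \<open>power\<close> on vectors is componentwise, hence a separate matrix power.\<close>

primrec mat_pow :: "real^'n^'n \<Rightarrow> nat \<Rightarrow> real^'n^'n" where
  "mat_pow M 0 = mat 1"
| "mat_pow M (Suc k) = M ** mat_pow M k"

definition mat_poly :: "real poly \<Rightarrow> real^'n^'n \<Rightarrow> real^'n^'n" where
  "mat_poly p M = (\<Sum>k\<le>degree p. coeff p k *\<^sub>R mat_pow M k)"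

definition poly_algebra :: "real^'n^'n \<Rightarrow> (real^'n^'n) set" where
  "poly_algebra M = range (\<lambda>p. mat_poly p M)"

definition char_polynomial :: "real^'n^'n \<Rightarrow> real poly" where
  "char_polynomial M = det (\<chi> i j. (if i = j then [:0, 1:] else 0) - [:M $ i $ j:])"

definition min_polynomial :: "real^'n^'n \<Rightarrow> real poly" where
  "min_polynomial M =
     (THE p. lead_coeff p = 1 \<and> mat_poly p M = 0 \<and>
             (\<forall>q. q \<noteq> 0 \<and> mat_poly q M = 0 \<longrightarrow> degree p \<le> degree q))"

definition nonderogatory :: "real^'n^'n \<Rightarrow> bool" where
  "nonderogatory M \<longleftrightarrow> char_polynomial M = min_polynomial M"

text \<open>\<open>\<real> \<I> \<oplus> \<hh>\<close>; for \<^term>\<open>h \<subseteq> sl\<close> the sum is direct because the identity has nonzero trace.\<close>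

definition add_scalars :: "(real^'n^'n) set \<Rightarrow> (real^'n^'n) set" where
  "add_scalars h = {c *\<^sub>R mat 1 + X |c X. X \<in> h}"


section \<open>Semidirect products and the Lie algebras of the affine groups\<close>

text \<open>
  For an abelian \<^term>\<open>B\<close>, the Lie algebra \<open>B \<ltimes> \<real>\<^sup>n\<close> has carrier \<^term>\<open>B \<times> UNIV\<close>; its bracket is the
  bilinear alternating extension of \<open>[a,b] = [x,y] = 0\<close> and \<open>[a,x] = a x\<close>.
\<close>

definition semidirect :: "(real^'n^'n) set \<Rightarrow> ((real^'n^'n) \<times> (real^'n)) set" where
  "semidirect B = B \<times> UNIV"

definition semidirect_bracket ::
    "(real^'n^'n) \<times> (real^'n) \<Rightarrow> (real^'n^'n) \<times> (real^'n) \<Rightarrow> (real^'n^'n) \<times> (real^'n)" where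
  "semidirect_bracket u v = (0, fst u *v snd v - fst v *v snd u)"

text \<open>
  The Lie algebra of the affine group of the line over \<open>\<real>\<close> or \<open>\<complex>\<close>: the pair \<open>(a, x)\<close> is the
  infinitesimal affine motion \<open>t \<mapsto> a t + x\<close>.
\<close>

definition aff_bracket :: "'k::real_normed_field \<times> 'k \<Rightarrow> 'k \<times> 'k \<Rightarrow> 'k \<times> 'k" where
  "aff_bracket u v = (0, fst u * snd v - fst v * snd u)"

abbreviation aff_real_bracket :: "real \<times> real \<Rightarrow> real \<times> real \<Rightarrow> real \<times> real" where
  "aff_real_bracket \<equiv> aff_bracket"

abbreviation aff_complex_bracket ::
    "complex \<times> complex \<Rightarrow> complex \<times> complex \<Rightarrow> complex \<times> complex" where
  "aff_complex_bracket \<equiv> aff_bracket"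

lemma aff_real_basis: "aff_real_bracket (1, 0) (0, 1) = (0, 1)"
  by (simp add: aff_bracket_def)

lemma aff_complex_basis:
  defines "e1 \<equiv> (1, 0)" and "e2 \<equiv> (\<i>, 0)" and "e3 \<equiv> (0, 1)" and "e4 \<equiv> (0, \<i>)"
  shows "aff_complex_bracket e1 e3 = e3" "aff_complex_bracket e1 e4 = e4"
    "aff_complex_bracket e2 e3 = e4" "aff_complex_bracket e2 e4 = - e3"
    "aff_complex_bracket e1 e2 = 0" "aff_complex_bracket e3 e4 = 0"
  by (simp_all add: aff_bracket_def e1_def e2_def e3_def e4_def zero_prod_def)

text \<open>
  The Lie algebra \<^term>\<open>L\<close> is the direct sum of \<^term>\<open>p\<close> copies of the complex and \<^term>\<open>q\<close> copies of
  the real affine algebra.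

  If a Cartan subalgebra \<open>\<hh>\<close> of \<open>sl(n, \<real>)\<close> has \<open>p\<close> two-dimensional (complex) and \<open>q\<close>
  one-dimensional (real) blocks, then \<open>n = 2 p + q\<close>. Its toroidal part has dimension \<open>p\<close>, but
  its vector part has dimension \<open>p + q - 1\<close>: one real parameter for each of the \<open>p + q\<close> blocks,
  minus one because the trace vanishes. So the number \<open>q\<close> of copies of \<open>aff(\<real>)\<close> in
  \<open>(\<real> \<I> \<oplus> \<hh>) \<ltimes> \<real>\<^sup>n\<close> satisfies \<open>p + q = dim \<hh>\<^sup>- + 1\<close>; it equals \<open>dim \<hh>\<^sup>-\<close> only for \<open>p = 1\<close>.
\<close>

definition is_sum_of_affs ::
    "'a::real_vector set \<Rightarrow> ('a \<Rightarrow> 'a \<Rightarrow> 'a) \<Rightarrow> nat \<Rightarrow> nat \<Rightarrow> bool" where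
  "is_sum_of_affs L br p q \<longleftrightarrow>
     (\<exists>A. lie_direct_sum L br {..<p + q} A \<and>
          (\<forall>i\<in>{..<p}. lie_isomorphic UNIV aff_complex_bracket (A i) br) \<and>
          (\<forall>i\<in>{p..<p + q}. lie_isomorphic UNIV aff_real_bracket (A i) br))"

end

theory Submission
  imports Defs "HOL-Computational_Algebra.Fundamental_Theorem_Algebra"
begin

text \<open>
  A Cartan subalgebra is self-normalizing, so by Engel's argument \<open>B = \<real> \<I> \<oplus> \<hh>\<close> contains every
  matrix on which all \<open>ad b\<close>, \<open>b \<in> B\<close>, are nilpotent. Over the complex numbers this applies to
  \<open>u \<phi>\<^sup>T\<close> for a generalized weight vector \<open>u\<close> and a generalized weight covector \<open>\<phi>\<close> of the same
  weight. As \<open>B\<close> is commutative, all these rank-one matrices commute, which forces every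
  weight space to be a line. Hence \<open>B\<close> is diagonalizable with distinct weights, a generic
  \<open>M \<in> B\<close> has distinct eigenvalues, and \<open>B\<close> is the centralizer \<open>\<real>[M]\<close> of \<open>M\<close>. Everything about
  \<open>\<real>[M]\<close> is read off the coordinates in a basis of eigenvectors of \<open>M\<close> stable under complex
  conjugation: each real eigenvalue contributes a block \<open>aff(\<real>)\<close> and each conjugate pair a block
  \<open>aff(\<complex>)\<close>. Conversely, the blocks of a sum of affine algebras provide the projections and
  complex structures from which a suitable \<open>M\<close> is assembled.
\<close>

section \<open>Complexification, eigenvectors and polynomials of a matrix\<close>

text \<open>Two obstacles shape the first half. \<open>B\<close> is only a real linear space of
  commuting matrices, with no closure under products known in advance, and its weights are complex.
  Hence weights are taken with respect to a finite real basis of \<open>B\<close>, acting on complex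
  vectors, and what Engel's argument places in \<open>B\<close> are the real and imaginary parts of
  \<open>u \<phi>\<^sup>T\<close>. A suitable covector exists because weight covectors span, and its
  weight comes for free: vectors and covectors of different weights pair to zero. The return to the
  reals rests on one symmetry condition: the elements of \<real>[M] correspond exactly to the
  families of diagonal entries that are symmetric under conjugation of the eigenvalues, so the
  orbits of that involution are the blocks. In the converse direction the independence of the blocks
  is never proved. The blocks span, which gives n \<le> 2p + q, and the assembled \<open>M\<close>
  has 2p + q distinct eigenvalues, which gives the other inequality.\<close>

definition cvec :: "real^'n \<Rightarrow> complex^'n" where
  "cvec x = (\<chi> i. complex_of_real (x $ i))"

definition cmat :: "real^'n^'m \<Rightarrow> complex^'n^'m" where
  "cmat X = (\<chi> i j. complex_of_real (X $ i $ j))"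

definition cnj_vec :: "complex^'n \<Rightarrow> complex^'n" where
  "cnj_vec w = (\<chi> i. cnj (w $ i))"

definition Re_vec :: "complex^'n \<Rightarrow> real^'n" where
  "Re_vec w = (\<chi> i. Re (w $ i))"

definition Im_vec :: "complex^'n \<Rightarrow> real^'n" where
  "Im_vec w = (\<chi> i. Im (w $ i))"

definition Re_mat :: "complex^'n^'m \<Rightarrow> real^'n^'m" where
  "Re_mat Y = (\<chi> i j. Re (Y $ i $ j))"

definition Im_mat :: "complex^'n^'m \<Rightarrow> real^'n^'m" where
  "Im_mat Y = (\<chi> i j. Im (Y $ i $ j))"

lemma cvec_nth [simp]: "cvec x $ i = complex_of_real (x $ i)"
  and cmat_nth [simp]: "cmat X $ i $ j = complex_of_real (X $ i $ j)"
  and cnj_vec_nth [simp]: "cnj_vec w $ i = cnj (w $ i)"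
  and Re_vec_nth [simp]: "Re_vec w $ i = Re (w $ i)"
  and Im_vec_nth [simp]: "Im_vec w $ i = Im (w $ i)"
  and Re_mat_nth [simp]: "Re_mat Y $ i $ j = Re (Y $ i $ j)"
  and Im_mat_nth [simp]: "Im_mat Y $ i $ j = Im (Y $ i $ j)"
  by (simp_all add: cvec_def cmat_def cnj_vec_def Re_vec_def Im_vec_def Re_mat_def Im_mat_def)


lemma cmat_mult: "cmat (X ** Y) = cmat X ** cmat Y"
  by (simp add: vec_eq_iff matrix_matrix_mult_def)

lemma cmat_mult_cvec: "cmat X *v cvec x = cvec (X *v x)"
  by (simp add: vec_eq_iff matrix_vector_mult_def)

lemma cmat_add: "cmat (X + Y) = cmat X + cmat Y"
  and cmat_diff: "cmat (X - Y) = cmat X - cmat Y"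
  and cmat_scaleR: "cmat (r *\<^sub>R X) = r *\<^sub>R cmat X"
  and cmat_0 [simp]: "cmat 0 = 0"
  and cmat_1 [simp]: "cmat (mat 1 :: real^'n^'n) = mat 1"
  by (simp_all add: vec_eq_iff scaleR_conv_of_real[where 'a = complex] mat_def)

lemma cmat_inject [simp]: "cmat X = cmat Y \<longleftrightarrow> X = Y"
  by (simp add: vec_eq_iff)

lemma cvec_add: "cvec (x + y) = cvec x + cvec y"
  and cvec_scaleR: "cvec (r *\<^sub>R x) = complex_of_real r *s cvec x"
  and cvec_0 [simp]: "cvec 0 = 0"
  by (simp_all add: vec_eq_iff)

lemma cvec_diff: "cvec (x - y) = cvec x - cvec y"
  by (simp add: vec_eq_iff)

lemma cvec_inject [simp]: "cvec x = cvec y \<longleftrightarrow> x = y"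
  by (simp add: vec_eq_iff)

lemma cnj_vec_cnj_vec [simp]: "cnj_vec (cnj_vec w) = w"
  and cnj_vec_cvec [simp]: "cnj_vec (cvec x) = cvec x"
  and cnj_vec_smult: "cnj_vec (c *s w) = cnj c *s cnj_vec w"
  and cnj_vec_0 [simp]: "cnj_vec 0 = 0"
  by (simp_all add: vec_eq_iff)

lemma cnj_vec_eq_0 [simp]: "cnj_vec w = 0 \<longleftrightarrow> w = 0"
  by (simp add: vec_eq_iff)

lemma cnj_vec_sum: "cnj_vec (\<Sum>i\<in>I. f i) = (\<Sum>i\<in>I. cnj_vec (f i))"
  by (simp add: vec_eq_iff)

lemma cnj_vec_cmat: "cnj_vec (cmat X *v w) = cmat X *v cnj_vec w"
  by (simp add: vec_eq_iff matrix_vector_mult_def)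

lemma cvec_Re_vec: "cnj_vec w = w \<Longrightarrow> cvec (Re_vec w) = w"
  by (simp add: vec_eq_iff complex_eq_iff)

lemma scaleR_matrix_vector_mult: "(r *\<^sub>R X) *v w = complex_of_real r *s (X *v w)" for X :: "complex^'n^'n"
  by (simp add: vec_eq_iff matrix_vector_mult_def scaleR_conv_of_real[where 'a = complex]
      sum_distrib_left mult.assoc)

lemma eigen_decomposition:
  fixes w :: "complex^'n"
  shows "cmat M *v w = z *s w \<longleftrightarrow>
    M *v Re_vec w = Re z *\<^sub>R Re_vec w - Im z *\<^sub>R Im_vec w \<and>
    M *v Im_vec w = Im z *\<^sub>R Re_vec w + Re z *\<^sub>R Im_vec w"
  by (auto simp: vec_eq_iff complex_eq_iff matrix_vector_mult_def algebra_simps)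

lemma complex_eigenvalues_iff:
  "z \<in> complex_eigenvalues UNIV ((*v) M) \<longleftrightarrow> (\<exists>w. w \<noteq> 0 \<and> cmat M *v w = z *s w)"
proof
  assume "z \<in> complex_eigenvalues UNIV ((*v) M)"
  then obtain u v where uv: "u \<noteq> 0 \<or> v \<noteq> 0" "M *v u = Re z *\<^sub>R u - Im z *\<^sub>R v"
     "M *v v = Im z *\<^sub>R u + Re z *\<^sub>R v"
    by (auto simp: complex_eigenvalues_def)
  define w where "w = (\<chi> i. Complex (u $ i) (v $ i))"
  have "Re_vec w = u" "Im_vec w = v"
    by (simp_all add: w_def vec_eq_iff)
  moreover from this have "w \<noteq> 0" using uv(1) by (auto simp: vec_eq_iff) (metis complex.sel zero_complex.sel)+
  ultimately show "\<exists>w. w \<noteq> 0 \<and> cmat M *v w = z *s w"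
    using uv eigen_decomposition[of M w z] by auto
next
  assume "\<exists>w. w \<noteq> 0 \<and> cmat M *v w = z *s w"
  then obtain w where w: "w \<noteq> 0" "cmat M *v w = z *s w" by blast
  have "Re_vec w \<noteq> 0 \<or> Im_vec w \<noteq> 0"
    using w(1) by (auto simp: vec_eq_iff complex_eq_iff)
  then show "z \<in> complex_eigenvalues UNIV ((*v) M)"
    using w(2) unfolding eigen_decomposition complex_eigenvalues_def by blast
qed

lemma complex_eigenvaluesI:
  assumes "u \<noteq> 0" "T u = Re z *\<^sub>R u - Im z *\<^sub>R v" "T v = Im z *\<^sub>R u + Re z *\<^sub>R v"
  shows "z \<in> complex_eigenvalues UNIV T"
  using assms by (auto simp: complex_eigenvalues_def)

section \<open>Polynomials evaluated at a matrix\<close>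

definition poly_act :: "complex poly \<Rightarrow> complex^'n^'n \<Rightarrow> complex^'n \<Rightarrow> complex^'n" where
  "poly_act p C w = fold_coeffs (\<lambda>a x. a *s w + C *v x) p 0"

lemma poly_act_0 [simp]: "poly_act 0 C w = 0"
  by (simp add: poly_act_def)

lemma poly_act_pCons [simp]: "poly_act (pCons a p) C w = a *s w + C *v poly_act p C w"
  by (cases "p = 0 \<and> a = 0") (auto simp: poly_act_def)

lemma poly_act_add: "poly_act (p + q) C w = poly_act p C w + poly_act q C w"
  by (induction p q rule: poly_induct2)
    (simp_all add: vec.add vector_sadd_rdistrib algebra_simps)

lemma poly_act_smult: "poly_act (smult c p) C w = c *s poly_act p C w"
  by (induction p) (simp_all add: vec.add vec.scale vec.scale_right_distrib)

lemma poly_act_mult: "poly_act (p * q) C w = poly_act p C (poly_act q C w)"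
  by (induction p) (simp_all add: poly_act_add poly_act_smult)

lemma poly_act_vadd: "poly_act p C (v + w) = poly_act p C v + poly_act p C w"
  by (induction p) (simp_all add: vec.add vec.scale_right_distrib)

lemma poly_act_vscale: "poly_act p C (c *s w) = c *s poly_act p C w"
  by (induction p) (simp_all add: vec.scale vec.scale_right_distrib mult.commute)

lemma poly_act_vzero [simp]: "poly_act p C 0 = 0"
  by (induction p) simp_all

lemma poly_act_vsum: "poly_act p C (\<Sum>i\<in>I. f i) = (\<Sum>i\<in>I. poly_act p C (f i))"
  by (induction I rule: infinite_finite_induct) (simp_all add: poly_act_vadd)

lemma poly_act_sum: "poly_act (\<Sum>i\<in>I. f i) C w = (\<Sum>i\<in>I. poly_act (f i) C w)"
  by (induction I rule: infinite_finite_induct) (simp_all add: poly_act_add)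

lemma poly_act_eigenvector: "C *v w = z *s w \<Longrightarrow> poly_act p C w = poly p z *s w"
  by (induction p) (simp_all add: vec.scale vector_sadd_rdistrib mult.commute)

lemma mat_poly_upto:
  assumes "degree p \<le> N"
  shows "mat_poly p M = (\<Sum>k\<le>N. coeff p k *\<^sub>R mat_pow M k)"
  unfolding mat_poly_def using assms
  by (intro sum.mono_neutral_left) (auto simp: coeff_eq_0)

lemma sum_matrix_vector_mult: "(\<Sum>i\<in>I. X i) *v w = (\<Sum>i\<in>I. X i *v w)" for w :: "real^'n"
  by (induction I rule: infinite_finite_induct) (simp_all add: matrix_vector_mult_add_rdistrib)

lemma matrix_mult_sum_right: "A ** (\<Sum>i\<in>I. f i) = (\<Sum>i\<in>I. A ** f i)" for A :: "real^'n^'n"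
  by (induction I rule: infinite_finite_induct) (simp_all add: matrix_add_ldistrib)

lemma mat_poly_0 [simp]: "mat_poly 0 M = 0"
  by (simp add: mat_poly_def)

text \<open>Horner's recursion. It opens \<open>mat_poly\<close>, a sum whose range depends on the
  degree, to induction over \<open>pCons\<close>.\<close>

lemma mat_poly_pCons: "mat_poly (pCons a p) M = a *\<^sub>R mat 1 + M ** mat_poly p M"
proof -
  have "mat_poly (pCons a p) M = (\<Sum>k\<le>Suc (degree p). coeff (pCons a p) k *\<^sub>R mat_pow M k)"
    by (intro mat_poly_upto) (simp add: degree_pCons_le)
  also have "\<dots> = a *\<^sub>R mat 1 + (\<Sum>k\<le>degree p. coeff p k *\<^sub>R (M ** mat_pow M k))"
    by (simp add: sum.atMost_Suc_shift del: sum.atMost_Suc)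
  also have "(\<Sum>k\<le>degree p. coeff p k *\<^sub>R (M ** mat_pow M k)) = M ** mat_poly p M"
    by (simp add: mat_poly_def matrix_mult_sum_right matrix_scalar_ac
        flip: scalar_matrix_assoc)
  finally show ?thesis .
qed

lemma matrix_add_rdistrib: "(A + B) ** C = A ** C + B ** C" for A B C :: "real^'n^'n"
  by (simp add: vec_eq_iff matrix_matrix_mult_def sum.distrib algebra_simps)

lemma mat_poly_commute:
  assumes "X ** M = M ** X"
  shows "X ** mat_poly p M = mat_poly p M ** X"
proof (induction p)
  case (pCons a p)
  have "X ** (M ** mat_poly p M) = M ** (mat_poly p M ** X)"
    using assms pCons.IH by (metis matrix_mul_assoc)
  then show ?case
    by (simp add: mat_poly_pCons matrix_add_ldistrib matrix_add_rdistrib matrix_scalar_ac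
        matrix_mul_assoc flip: scalar_matrix_assoc)
qed simp

lemma cmat_mat_poly: "cmat (mat_poly p M) *v w = poly_act (map_poly of_real p) (cmat M) w"
  by (induction p)
    (simp_all add: mat_poly_pCons map_poly_pCons cmat_add cmat_scaleR cmat_mult
      matrix_vector_mult_add_rdistrib scaleR_matrix_vector_mult flip: matrix_vector_mul_assoc)

text \<open>Applying \<open>q\<close>, which vanishes at every eigenvalue in \<open>S\<close> except
  \<open>z\<close>, reduces the relation to a single term with nonzero factor.\<close>

lemma eigenvectors_independent:
  fixes C :: "complex^'n^'n"
  assumes "finite S" "\<And>z. z \<in> S \<Longrightarrow> C *v V z = z *s V z" "\<And>z. z \<in> S \<Longrightarrow> V z \<noteq> 0"
    and "(\<Sum>z\<in>S. c z *s V z) = 0" "z \<in> S"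
  shows "c z = 0"
proof -
  define q where "q = (\<Prod>w\<in>S-{z}. [:-w, 1:])"
  have q: "poly q w = (\<Prod>y\<in>S-{z}. w - y)" for w
    by (simp add: q_def poly_prod)
  have "0 = poly_act q C (\<Sum>z\<in>S. c z *s V z)" using assms by simp
  also have "\<dots> = (\<Sum>y\<in>S. (c y * poly q y) *s V y)"
    unfolding poly_act_vsum by (intro sum.cong) (simp_all add: poly_act_vscale assms poly_act_eigenvector)
  also have "\<dots> = (\<Sum>y\<in>{z}. (c y * poly q y) *s V y)"
    using assms(1,5) by (intro sum.mono_neutral_right) (auto simp: q)
  finally have "c z * poly q z = 0" using assms(3,5) by simp
  moreover have "poly q z \<noteq> 0" using assms(1) by (auto simp: q)
  ultimately show ?thesis by simp
qed

text \<open>Independence of eigenvectors bounds every finite subset of \<open>S\<close>; an infinite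
  \<open>S\<close> would contain a subset with one element too many.\<close>

lemma card_eigenvalues_le:
  fixes C :: "complex^'n^'n"
  assumes "S \<subseteq> {z. \<exists>w. w \<noteq> 0 \<and> C *v w = z *s w}"
  shows "finite S \<and> card S \<le> CARD('n)"
proof -
  have fin: "card F \<le> CARD('n)" if F: "finite F" "F \<subseteq> S" for F
  proof -
    have "\<forall>z\<in>F. \<exists>w. w \<noteq> 0 \<and> C *v w = z *s w" using assms F by blast
    then obtain V where V: "\<And>z. z \<in> F \<Longrightarrow> V z \<noteq> 0" "\<And>z. z \<in> F \<Longrightarrow> C *v V z = z *s V z"
      by metis
    have inj: "inj_on V F"
    proof (rule inj_onI, rule ccontr)
      fix x y assume xy: "x \<in> F" "y \<in> F" "V x = V y" "x \<noteq> y"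
      then have "x *s V x = y *s V x" using V(2) by metis
      then have "(x - y) *s V x = 0" by (simp add: vec.scale_left_diff_distrib)
      then show False using xy V(1)[of x] by (simp add: vec.scale_eq_0_iff)
    qed
    have "vec.independent (V ` F)"
    proof
      assume "vec.dependent (V ` F)"
      then obtain u where u: "\<exists>v\<in>V ` F. u v \<noteq> 0" "(\<Sum>v\<in>V ` F. u v *s v) = 0"
        using F(1) by (auto simp: vec.dependent_finite)
      have "(\<Sum>z\<in>F. u (V z) *s V z) = 0"
        using u(2) inj by (simp add: sum.reindex)
      from eigenvectors_independent[OF F(1) V(2) V(1) this] u(1) show False by auto
    qed
    then have "card (V ` F) \<le> vec.dim (UNIV :: (complex^'n) set)"
      by (intro vec.independent_card_le_dim) auto
    then show ?thesis using inj by (simp add: card_image vec_dim_card del: vec.dim_UNIV)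
  qed
  have "finite S"
  proof (rule ccontr)
    assume "infinite S"
    then obtain F where "F \<subseteq> S" "finite F" "card F = Suc CARD('n)"
      using infinite_arbitrarily_large by blast
    with fin[of F] show False by simp
  qed
  with fin show ?thesis by blast
qed

section \<open>Weight vectors of a self-normalizing commutative algebra\<close>

text \<open>The vectors \<open>f k\<close> for \<open>k \<le> CARD('n)\<close> exceed the dimension
  in number, and a linear relation among them is a polynomial. The case split arises because
  dependence is a property of the set of vectors: a repetition \<open>f i = f j\<close> disappears
  from the set, but yields x^i - x^j directly.\<close>

lemma poly_act_annihilator:
  fixes C :: "complex^'n^'n"
  shows "\<exists>q. q \<noteq> 0 \<and> poly_act q C w = 0"
proof -
  define f where "f k = poly_act (monom 1 k) C w" for k
  show ?thesis
  proof (cases "inj_on f {..CARD('n)}")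
    case False
    then obtain i j where ij: "i \<noteq> j" "f i = f j" by (auto simp: inj_on_def)
    have "poly_act (monom 1 i + smult (-1) (monom 1 j)) C w = 0"
      using ij(2) unfolding poly_act_add poly_act_smult by (simp add: f_def)
    moreover have "coeff (monom 1 i + smult (-1) (monom 1 j) :: complex poly) i \<noteq> coeff 0 i"
      using ij(1) by simp
    ultimately show ?thesis by metis
  next
    case True
    define S where "S = f ` {..CARD('n)}"
    have fin: "finite S" by (simp add: S_def)
    have "card S = Suc CARD('n)" using True by (simp add: S_def card_image)
    moreover have "vec.dim S \<le> CARD('n)"
      using dim_subset_UNIV_cart_gen[of S] by simp
    ultimately have "vec.dependent S"
      by (intro vec.dependent_biggerset_general) simp
    then obtain u where u: "\<exists>v\<in>S. u v \<noteq> 0" "(\<Sum>v\<in>S. u v *s v) = 0"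
      using fin by (auto simp: vec.dependent_finite)
    define q where "q = (\<Sum>k\<le>CARD('n). smult (u (f k)) (monom 1 k))"
    have "poly_act q C w = (\<Sum>k\<le>CARD('n). u (f k) *s f k)"
      by (simp add: q_def poly_act_sum poly_act_smult f_def)
    also have "\<dots> = 0" using u(2) True by (simp add: S_def sum.reindex)
    finally have "poly_act q C w = 0" .
    moreover obtain k where k: "k \<le> CARD('n)" "u (f k) \<noteq> 0" using u(1) by (auto simp: S_def)
    have "coeff q k = u (f k)"
      using k(1) by (simp add: q_def coeff_sum if_distrib cong: if_cong)
    with k(2) have "q \<noteq> 0" by auto
    ultimately show ?thesis by blast
  qed
qed

text \<open>With c the value of \<open>q\<close> at \<mu>, the power \<open>(q - c) ^ k\<close> is
  divisible by \<open>[:-\<mu>, 1:] ^ k\<close> and differs from \<open>(- c) ^ k\<close> by a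
  multiple of \<open>q\<close>. So this nonzero constant is a combination of the two
  polynomials.\<close>

lemma bezout_linear_power:
  fixes q :: "complex poly"
  assumes "poly q \<mu> \<noteq> 0"
  shows "\<exists>a b. a * [:-\<mu>, 1:] ^ k + b * q = 1"
proof -
  define c where "c = [:poly q \<mu>:]"
  have "[:-\<mu>, 1:] dvd q - c" by (simp add: c_def flip: poly_eq_0_iff_dvd)
  then obtain r where r: "q - c = [:-\<mu>, 1:] * r" by (rule dvdE)
  define s where "s = (\<Sum>i<k. (- c) ^ (k - Suc i) * (q - c) ^ i)"
  have "(q - c) ^ k - (- c) ^ k = q * s"
    using power_diff_sumr2[of "q - c" k "- c"] by (simp add: s_def)
  then have "[:-\<mu>, 1:] ^ k * r ^ k - q * s = (- c) ^ k"
    unfolding r power_mult_distrib by (simp add: algebra_simps)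
  also have "(- c) ^ k = [:(- poly q \<mu>) ^ k:]"
    by (simp add: c_def poly_const_pow)
  finally have "smult (inverse ((- poly q \<mu>) ^ k)) ([:-\<mu>, 1:] ^ k * r ^ k - q * s) = 1"
    using assms by simp
  then have "smult (inverse ((- poly q \<mu>) ^ k)) (r ^ k) * [:-\<mu>, 1:] ^ k +
      smult (- inverse ((- poly q \<mu>) ^ k)) s * q = 1"
    by (simp add: algebra_simps smult_diff_right)
  then show ?thesis by blast
qed

lemma poly_act_in_invariant:
  assumes "vec.subspace U" "\<And>x. x \<in> U \<Longrightarrow> C *v x \<in> U" "w \<in> U"
  shows "poly_act p C w \<in> U"
  by (induction p) (auto intro!: vec.subspace_add vec.subspace_scale assms vec.subspace_0)

lemma poly_act_swap: "poly_act p C (poly_act q C w) = poly_act q C (poly_act p C w)"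
  by (metis mult.commute poly_act_mult)

text \<open>Primary decomposition inside \<open>U\<close>, by induction on the degree of an
  annihilating polynomial. Splitting off a root \<mu> with its full order leaves a coprime factor
  \<open>p\<close>; Bezout writes \<open>w\<close> as a part killed by \<open>p\<close> plus a part
  killed by the power of the linear factor, and both stay in \<open>U\<close> by invariance.\<close>

lemma generalized_eigenvectors_span:
  fixes C :: "complex^'n^'n"
  assumes U: "vec.subspace U" "\<And>x. x \<in> U \<Longrightarrow> C *v x \<in> U" and w: "w \<in> U"
  shows "w \<in> vec.span {x \<in> U. \<exists>\<mu> k. poly_act ([:-\<mu>, 1:] ^ k) C x = 0}" (is "_ \<in> vec.span ?G")
proof -
  obtain q where q: "q \<noteq> 0" "poly_act q C w = 0" using poly_act_annihilator by blast
  then show ?thesis using w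
  proof (induction "degree q" arbitrary: q w rule: less_induct)
    case less
    show ?case
    proof (cases "degree q = 0")
      case True
      then obtain c where "q = [:c:]" by (rule degree_eq_zeroE)
      then have "w = 0" using less.prems by simp
      then show ?thesis by (simp add: vec.span_zero)
    next
      case False
      then obtain \<mu> where \<mu>: "poly q \<mu> = 0"
        using fundamental_theorem_of_algebra[of q] constant_degree[of q] by auto
      define k where "k = order \<mu> q"
      obtain p where p: "q = [:-\<mu>, 1:] ^ k * p" "\<not> [:-\<mu>, 1:] dvd p"
        using order_decomp[OF less.prems(1)] k_def by blast
      have pmu: "poly p \<mu> \<noteq> 0" using p(2) by (simp add: poly_eq_0_iff_dvd)
      obtain a b where ab: "a * [:-\<mu>, 1:] ^ k + b * p = 1"
        using bezout_linear_power[OF pmu] by blast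
      have k: "k \<noteq> 0" using \<mu> less.prems(1) by (simp add: k_def order_root)
      have p0: "p \<noteq> 0" using less.prems p by auto
      have "degree q = k + degree p"
        unfolding p(1) using p0 by (subst degree_mult_eq) (simp_all add: degree_power_eq)
      then have deg: "degree p < degree q" using k by simp
      define w1 where "w1 = poly_act (a * [:-\<mu>, 1:] ^ k) C w"
      define w2 where "w2 = poly_act (b * p) C w"
      have "w1 + w2 = poly_act 1 C w" by (simp add: w1_def w2_def flip: poly_act_add ab)
      then have w12: "w = w1 + w2" by (simp add: one_pCons)
      have inU: "w1 \<in> U" "w2 \<in> U"
        unfolding w1_def w2_def by (intro poly_act_in_invariant U less.prems; assumption)+
      have "poly_act p C w1 = poly_act a C (poly_act q C w)"
        unfolding w1_def p(1) by (simp add: mult_ac flip: poly_act_mult)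
      then have "w1 \<in> vec.span ?G"
        using less.hyps[OF deg p0 _ inU(1)] less.prems(2) by simp
      moreover have "poly_act ([:-\<mu>, 1:] ^ k) C w2 = poly_act b C (poly_act q C w)"
        unfolding w2_def p(1) by (simp add: mult_ac flip: poly_act_mult)
      then have "w2 \<in> ?G" using less.prems(2) inU by auto
      then have "w2 \<in> vec.span ?G" by (rule vec.span_base)
      ultimately show ?thesis unfolding w12 by (rule vec.span_add)
    qed
  qed
qed

definition weight_vector :: "(complex^'n^'n) set \<Rightarrow> (complex^'n^'n \<Rightarrow> complex) \<Rightarrow> complex^'n \<Rightarrow> bool"
  where "weight_vector S \<theta> w \<longleftrightarrow> (\<forall>b\<in>S. \<exists>k. poly_act ([:- \<theta> b, 1:] ^ k) b w = 0)"

lemma poly_act_commute: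
  assumes "A ** C = C ** A"
  shows "poly_act p C (A *v w) = A *v poly_act p C w"
proof (induction p)
  case (pCons a p)
  have "C *v (A *v x) = A *v (C *v x)" for x
    using assms by (simp add: matrix_vector_mul_assoc)
  then show ?case by (simp add: pCons vec.add vec.scale)
qed simp

lemma poly_act_power_le:
  assumes "poly_act (p ^ k) C w = 0" "k \<le> l"
  shows "poly_act (p ^ l) C w = 0"
proof -
  have "p ^ l = p ^ (l - k) * p ^ k" using assms(2) by (simp flip: power_add)
  then show ?thesis using assms(1) by (simp add: poly_act_mult)
qed

lemma weight_vector_mult:
  assumes "weight_vector S \<theta> w" "\<And>b. b \<in> S \<Longrightarrow> A ** b = b ** A"
  shows "weight_vector S \<theta> (A *v w)"
  using assms unfolding weight_vector_def by (metis poly_act_commute vec.zero)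

lemma subspace_weight_vectors: "vec.subspace {w. weight_vector S \<theta> w}"
proof (rule vec.subspaceI)
  show "0 \<in> {w. weight_vector S \<theta> w}" by (simp add: weight_vector_def)
next
  fix v w assume vw: "v \<in> {w. weight_vector S \<theta> w}" "w \<in> {w. weight_vector S \<theta> w}"
  have "\<exists>k. poly_act ([:- \<theta> b, 1:] ^ k) b (v + w) = 0" if b: "b \<in> S" for b
  proof -
    obtain k l where "poly_act ([:- \<theta> b, 1:] ^ k) b v = 0" "poly_act ([:- \<theta> b, 1:] ^ l) b w = 0"
      using vw b unfolding weight_vector_def mem_Collect_eq by blast
    then have "poly_act ([:- \<theta> b, 1:] ^ max k l) b v = 0" "poly_act ([:- \<theta> b, 1:] ^ max k l) b w = 0"
      by (auto intro: poly_act_power_le)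
    then show ?thesis by (metis poly_act_vadd add_0)
  qed
  then show "v + w \<in> {w. weight_vector S \<theta> w}" by (auto simp: weight_vector_def)
next
  fix c v assume "v \<in> {w. weight_vector S \<theta> w}"
  then show "c *s v \<in> {w. weight_vector S \<theta> w}"
    by (auto simp: weight_vector_def poly_act_vscale)
qed

text \<open>A further \<open>b\<close> commutes with \<open>S\<close>, hence preserves each weight
  space of \<open>S\<close>, and \<open>generalized_eigenvectors_span\<close> splits that space into
  pieces on which the weight is extended by the eigenvalue of \<open>b\<close>.\<close>

lemma weight_vectors_span:
  fixes S :: "(complex^'n^'n) set"
  assumes "finite S" "\<And>b c. b \<in> S \<Longrightarrow> c \<in> S \<Longrightarrow> b ** c = c ** b"
  shows "vec.span {w. \<exists>\<theta>. weight_vector S \<theta> w} = UNIV"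
  using assms
proof (induction S rule: finite_induct)
  case empty
  then show ?case by (simp add: weight_vector_def)
next
  case (insert b S)
  have "w \<in> vec.span {w. \<exists>\<theta>. weight_vector (insert b S) \<theta> w}" if w: "weight_vector S \<theta> w" for w \<theta>
  proof -
    let ?U = "{w. weight_vector S \<theta> w}"
    have "w \<in> vec.span {x \<in> ?U. \<exists>\<mu> k. poly_act ([:-\<mu>, 1:] ^ k) b x = 0}"
      using w insert.prems
      by (intro generalized_eigenvectors_span subspace_weight_vectors) (auto intro: weight_vector_mult)
    moreover have "{x \<in> ?U. \<exists>\<mu> k. poly_act ([:-\<mu>, 1:] ^ k) b x = 0} \<subseteq>
        {w. \<exists>\<theta>. weight_vector (insert b S) \<theta> w}"
    proof clarify
      fix x \<mu> k assume x: "weight_vector S \<theta> x" "poly_act ([:-\<mu>, 1:] ^ k) b x = 0"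
      have "weight_vector (insert b S) (\<theta>(b := \<mu>)) x"
        using x insert.hyps(2) unfolding weight_vector_def by auto
      then show "\<exists>\<theta>. weight_vector (insert b S) \<theta> x" by blast
    qed
    ultimately show ?thesis using vec.span_mono by blast
  qed
  then have "{w. \<exists>\<theta>. weight_vector S \<theta> w} \<subseteq> vec.span {w. \<exists>\<theta>. weight_vector (insert b S) \<theta> w}"
    by blast
  then have "vec.span {w. \<exists>\<theta>. weight_vector S \<theta> w} \<subseteq> vec.span {w. \<exists>\<theta>. weight_vector (insert b S) \<theta> w}"
    by (simp add: vec.span_minimal)
  then show ?case using insert by auto
qed

text \<open>Bilinear rather than Hermitian: the adjoint is then the transpose, and polynomials cross
  the pairing without conjugation of their coefficients (\<open>cdot_poly_act\<close>).\<close>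

definition cdot :: "complex^'n \<Rightarrow> complex^'n \<Rightarrow> complex" where
  "cdot \<phi> u = (\<Sum>i\<in>UNIV. \<phi> $ i * u $ i)"

lemma cdot_linear:
  "cdot \<phi> (u + v) = cdot \<phi> u + cdot \<phi> v" "cdot \<phi> (c *s u) = c * cdot \<phi> u"
  "cdot (\<phi> + \<psi>) u = cdot \<phi> u + cdot \<psi> u" "cdot (c *s \<phi>) u = c * cdot \<phi> u"
  "cdot 0 u = 0" "cdot \<phi> 0 = 0"
  by (simp_all add: cdot_def sum.distrib distrib_left distrib_right sum_distrib_left mult_ac)

lemma cdot_mult: "cdot \<phi> (A *v u) = cdot (transpose A *v \<phi>) u"
  unfolding cdot_def matrix_vector_mult_def transpose_def
  by (simp add: sum_distrib_left sum_distrib_right mult_ac) (rule sum.swap)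

lemma cdot_poly_act: "cdot \<phi> (poly_act p A u) = cdot (poly_act p (transpose A) \<phi>) u"
proof (induction p arbitrary: \<phi>)
  case (pCons a p)
  have "cdot \<phi> (poly_act (pCons a p) A u) = a * cdot \<phi> u + cdot (poly_act p (transpose A) (transpose A *v \<phi>)) u"
    unfolding poly_act_pCons cdot_linear cdot_mult pCons.IH by simp
  also have "poly_act p (transpose A) (transpose A *v \<phi>) = transpose A *v poly_act p (transpose A) \<phi>"
    by (rule poly_act_commute) simp
  finally show ?case by (simp only: poly_act_pCons cdot_linear)
qed (simp add: cdot_linear)

text \<open>A power of b - \<theta> kills \<open>u\<close>, so Bezout exhibits \<open>u\<close> as a
  value of a power of b - \<psi>. Moved across the pairing, that power kills \<phi>.\<close>

lemma cdot_weight_vectors: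
  assumes "weight_vector S \<theta> u" "weight_vector (transpose ` S) \<psi> \<phi>" "b \<in> S"
    and "\<psi> (transpose b) \<noteq> \<theta> b"
  shows "cdot \<phi> u = 0"
proof -
  obtain k l where kl: "poly_act ([:- \<theta> b, 1:] ^ k) b u = 0"
    "poly_act ([:- \<psi> (transpose b), 1:] ^ l) (transpose b) \<phi> = 0"
    using assms(1-3) unfolding weight_vector_def by blast
  have "poly ([:- \<psi> (transpose b), 1:] ^ l) (\<theta> b) \<noteq> 0" using assms(4) by simp
  from bezout_linear_power[OF this] obtain a c where
    "a * [:- \<theta> b, 1:] ^ k + c * [:- \<psi> (transpose b), 1:] ^ l = 1" by blast
  then have "poly_act (a * [:- \<theta> b, 1:] ^ k + c * [:- \<psi> (transpose b), 1:] ^ l) b u = u"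
    by (simp add: one_pCons)
  then have "u = poly_act c b (poly_act ([:- \<psi> (transpose b), 1:] ^ l) b u)"
    by (simp add: poly_act_add poly_act_mult kl)
  then have "cdot \<phi> u = cdot \<phi> (poly_act ([:- \<psi> (transpose b), 1:] ^ l) b (poly_act c b u))"
    by (simp add: poly_act_swap)
  then show ?thesis by (simp add: cdot_poly_act kl cdot_linear)
qed

section \<open>Rank-one matrices under the adjoint action\<close>

definition outer :: "complex^'n \<Rightarrow> complex^'n \<Rightarrow> complex^'n^'n" where
  "outer u \<phi> = (\<chi> i j. u $ i * \<phi> $ j)"

lemma outer_nth [simp]: "outer u \<phi> $ i $ j = u $ i * \<phi> $ j"
  by (simp add: outer_def)

lemma mult_outer: "A ** outer u \<phi> = outer (A *v u) \<phi>"
  by (simp add: vec_eq_iff matrix_matrix_mult_def matrix_vector_mult_def sum_distrib_left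
      sum_distrib_right mult_ac)

lemma outer_mult: "outer u \<phi> ** A = outer u (transpose A *v \<phi>)"
  by (simp add: vec_eq_iff matrix_matrix_mult_def matrix_vector_mult_def transpose_def
      sum_distrib_left mult_ac del: transpose_matrix_vector)

lemma outer_outer_nth: "(outer u \<phi> ** outer u' \<phi>') $ i $ j = cdot \<phi> u' * (u $ i * \<phi>' $ j)"
  by (simp add: matrix_matrix_mult_def cdot_def sum_distrib_left sum_distrib_right mult_ac)

definition cad :: "complex^'n^'n \<Rightarrow> complex^'n^'n \<Rightarrow> complex^'n^'n" where
  "cad b Y = b ** Y - Y ** b"

lemma cad_diff: "cad b (X - Y) = cad b X - cad b Y"
  by (simp add: cad_def vec_eq_iff matrix_matrix_mult_def sum_subtractf algebra_simps)

lemma cad_power_diff: "(cad b ^^ k) (X - Y) = (cad b ^^ k) X - (cad b ^^ k) Y"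
  by (induction k) (simp_all add: cad_diff)

lemma cad_0 [simp]: "cad b 0 = 0"
  by (simp add: cad_def vec_eq_iff matrix_matrix_mult_def)

lemma cad_power_0 [simp]: "(cad b ^^ k) 0 = 0"
  by (induction k) simp_all

text \<open>Left and right multiplication by \<open>b - \<mu>\<close> commute, so their difference is nilpotent on
  \<open>u \<phi>\<^sup>T\<close> as soon as each of them is.\<close>

lemma cad_outer_nilpotent:
  assumes "poly_act ([:-\<mu>, 1:] ^ k) b u = 0" "poly_act ([:-\<mu>, 1:] ^ l) (transpose b) \<phi> = 0"
  shows "(cad b ^^ (k + l)) (outer u \<phi>) = 0"
  using assms
proof (induction "k + l" arbitrary: k l u \<phi>)
  case 0
  then have "u = 0" by (simp add: one_pCons)
  then have "outer u \<phi> = 0" by (simp add: vec_eq_iff)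
  then show ?case by simp
next
  case (Suc m)
  show ?case
  proof (cases "k = 0 \<or> l = 0")
    case True
    then have "u = 0 \<or> \<phi> = 0" using Suc.prems by (auto simp: one_pCons)
    then have "outer u \<phi> = 0" by (auto simp: vec_eq_iff)
    then show ?thesis by simp
  next
    case False
    then obtain k' l' where kl: "k = Suc k'" "l = Suc l'" by (meson not0_implies_Suc)
    define u' where "u' = poly_act [:-\<mu>, 1:] b u"
    define \<phi>' where "\<phi>' = poly_act [:-\<mu>, 1:] (transpose b) \<phi>"
    \<comment> \<open>The shift by \<mu> cancels in the commutator. Each term on the right has one
      exponent lowered, so the induction runs over \<open>k + l\<close>.\<close>
    have "cad b (outer u \<phi>) = outer u' \<phi> - outer u \<phi>'"
      by (simp add: cad_def mult_outer outer_mult u'_def \<phi>'_def vec_eq_iff algebra_simps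
          del: transpose_matrix_vector)
    moreover have "poly_act ([:-\<mu>, 1:] ^ k') b u' = 0"
      using Suc.prems(1) unfolding kl power_Suc2 poly_act_mult u'_def .
    then have "(cad b ^^ m) (outer u' \<phi>) = 0"
      using Suc.hyps(1)[of k' l u' \<phi>] Suc.hyps(2) Suc.prems(2) kl by simp
    moreover have "poly_act ([:-\<mu>, 1:] ^ l') (transpose b) \<phi>' = 0"
      using Suc.prems(2) unfolding kl power_Suc2 poly_act_mult \<phi>'_def .
    then have "(cad b ^^ m) (outer u \<phi>') = 0"
      using Suc.hyps(1)[of k l' u \<phi>'] Suc.hyps(2) Suc.prems(1) kl by simp
    ultimately show ?thesis
      unfolding Suc.hyps(2)[symmetric] funpow_Suc_right by (simp add: cad_power_diff)
  qed
qed

lemma cad_cmat: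
  "Re_mat (cad (cmat b) Y) = mat_bracket b (Re_mat Y)"
  "Im_mat (cad (cmat b) Y) = mat_bracket b (Im_mat Y)"
  by (simp_all add: cad_def mat_bracket_def vec_eq_iff matrix_matrix_mult_def)

lemma cad_power_cmat:
  "Re_mat ((cad (cmat b) ^^ k) Y) = (mat_bracket b ^^ k) (Re_mat Y)"
  "Im_mat ((cad (cmat b) ^^ k) Y) = (mat_bracket b ^^ k) (Im_mat Y)"
  by (induction k) (simp_all add: cad_cmat)

text \<open>Membership in \<open>B\<close>, and with it commutativity, is available only for real
  and imaginary parts.\<close>

lemma commute_from_parts:
  fixes Y Z :: "complex^'n^'n"
  assumes "Re_mat Y ** Re_mat Z = Re_mat Z ** Re_mat Y" "Re_mat Y ** Im_mat Z = Im_mat Z ** Re_mat Y"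
    "Im_mat Y ** Re_mat Z = Re_mat Z ** Im_mat Y" "Im_mat Y ** Im_mat Z = Im_mat Z ** Im_mat Y"
  shows "Y ** Z = Z ** Y"
proof -
  have Re: "Re_mat (A ** B) = Re_mat A ** Re_mat B - Im_mat A ** Im_mat B" for A B :: "complex^'n^'n"
    by (simp add: vec_eq_iff matrix_matrix_mult_def sum_subtractf)
  have Im: "Im_mat (A ** B) = Re_mat A ** Im_mat B + Im_mat A ** Re_mat B" for A B :: "complex^'n^'n"
    by (simp add: vec_eq_iff matrix_matrix_mult_def sum.distrib)
  have "Re_mat (Y ** Z) = Re_mat (Z ** Y)" "Im_mat (Y ** Z) = Im_mat (Z ** Y)"
    unfolding Re Im using assms by (simp_all add: add.commute)
  then show ?thesis by (simp add: vec_eq_iff complex_eq_iff)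
qed

section \<open>Adjoint operators of real matrices and Engel's argument\<close>

lemma mat_bracket_simps:
  "mat_bracket X 0 = 0" "mat_bracket 0 X = 0"
  "mat_bracket X (Y + Z) = mat_bracket X Y + mat_bracket X Z"
  "mat_bracket (Y + Z) X = mat_bracket Y X + mat_bracket Z X"
  "mat_bracket X (r *\<^sub>R Y) = r *\<^sub>R mat_bracket X Y"
  "mat_bracket (r *\<^sub>R Y) X = r *\<^sub>R mat_bracket Y X"
  by (simp_all add: mat_bracket_def vec_eq_iff matrix_matrix_mult_def sum.distrib sum_distrib_left
      algebra_simps)

text \<open>The Jacobi identity with vanishing \<open>[b, c]\<close>.\<close>

lemma mat_bracket_swap:
  assumes "mat_bracket b c = 0"
  shows "mat_bracket b (mat_bracket c Y) = mat_bracket c (mat_bracket b Y)"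
proof -
  have *: "b ** c = c ** b" using assms by (simp add: mat_bracket_def)
  have sub: "A ** (B - C) = A ** B - A ** C" "(B - C) ** A = B ** A - C ** A" for A B C :: "real^'n^'n"
    by (simp_all add: vec_eq_iff matrix_matrix_mult_def sum_subtractf algebra_simps)
  have "b ** c ** Y = c ** b ** Y" "Y ** (c ** b) = Y ** (b ** c)" using * by simp_all
  then show ?thesis
    by (simp add: mat_bracket_def sub matrix_mul_assoc)
qed

lemma mat_bracket_power_swap:
  assumes "mat_bracket b c = 0"
  shows "(mat_bracket b ^^ k) (mat_bracket c Y) = mat_bracket c ((mat_bracket b ^^ k) Y)"
  by (induction k) (simp_all add: mat_bracket_swap[OF assms])

lemma mat_bracket_power_power_swap:
  assumes "mat_bracket b c = 0"
  shows "(mat_bracket b ^^ k) ((mat_bracket c ^^ l) Y) = (mat_bracket c ^^ l) ((mat_bracket b ^^ k) Y)"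
  using assms by (induction l) (simp_all add: mat_bracket_power_swap)

lemma mat_bracket_power_0 [simp]: "(mat_bracket b ^^ k) 0 = 0"
  by (induction k) (simp_all add: mat_bracket_simps)

text \<open>Engel's argument: from a \<open>Y \<notin> B\<close>, applying each \<open>ad b\<close> as often as possible without
  entering \<open>B\<close> would give a \<open>Z \<notin> B\<close> normalizing \<open>B\<close>.\<close>

lemma self_normalizing_engel:
  fixes B :: "(real^'n^'n) set"
  assumes S: "finite S" "S \<subseteq> B" and B: "subspace B"
    and ab: "\<And>X Y. X \<in> B \<Longrightarrow> Y \<in> B \<Longrightarrow> mat_bracket X Y = 0"
    and norm: "\<And>X. (\<And>b. b \<in> S \<Longrightarrow> mat_bracket b X \<in> B) \<Longrightarrow> X \<in> B"
    and nil: "\<And>b. b \<in> S \<Longrightarrow> \<exists>k. (mat_bracket b ^^ k) Y = 0"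
  shows "Y \<in> B"
proof (rule ccontr)
  assume Y: "Y \<notin> B"
  \<comment> \<open>Nilpotency on \<open>Z\<close> is carried along since the next \<open>b\<close>
    must take \<open>Z\<close> into \<open>B\<close> after finitely many applications.\<close>
  have "\<exists>Z. Z \<notin> B \<and> (\<forall>b\<in>F. mat_bracket b Z \<in> B) \<and> (\<forall>b\<in>S. \<exists>k. (mat_bracket b ^^ k) Z = 0)"
    if "finite F" "F \<subseteq> S" for F
    using that
  proof (induction F rule: finite_induct)
    case empty
    then show ?case using Y nil by auto
  next
    case (insert b F)
    then obtain Z where Z: "Z \<notin> B" "\<And>c. c \<in> F \<Longrightarrow> mat_bracket c Z \<in> B"
      "\<And>c. c \<in> S \<Longrightarrow> \<exists>k. (mat_bracket c ^^ k) Z = 0" by auto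
    have bS: "b \<in> S" "b \<in> B" using insert.prems S(2) by auto
    \<comment> \<open>As \<open>Z\<close> itself is outside \<open>B\<close>, this \<open>k\<close>
      is positive, and one application fewer gives the last iterate outside
      \<open>B\<close>.\<close>
    define k where "k = (LEAST k. (mat_bracket b ^^ k) Z \<in> B)"
    have "\<exists>k. (mat_bracket b ^^ k) Z \<in> B"
      using Z(3)[OF bS(1)] subspace_0[OF B] by metis
    then have k: "(mat_bracket b ^^ k) Z \<in> B" unfolding k_def by (rule LeastI_ex)
    then obtain r where r: "k = Suc r" using Z(1) by (cases k) auto
    define Z' where "Z' = (mat_bracket b ^^ r) Z"
    have "Z' \<notin> B" unfolding Z'_def using not_less_Least[of r "\<lambda>k. (mat_bracket b ^^ k) Z \<in> B"]
      by (simp add: r flip: k_def)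
    moreover have "mat_bracket b Z' \<in> B" using k by (simp add: Z'_def r)
    \<comment> \<open>The matrices treated earlier still normalize: \<open>ad b\<close> commutes
      with \<open>ad c\<close> and annihilates \<open>B\<close>, so its iterates keep
      \<open>mat_bracket c Z\<close> in \<open>B\<close>.\<close>
    moreover have "mat_bracket c Z' \<in> B" if c: "c \<in> F" for c
    proof -
      have cB: "c \<in> B" using c insert.prems S(2) by auto
      have W: "(mat_bracket b ^^ r) W \<in> B" if "W \<in> B" for W
        using that by (induction r) (simp_all add: ab bS subspace_0[OF B])
      have "mat_bracket c Z' = (mat_bracket b ^^ r) (mat_bracket c Z)"
        unfolding Z'_def by (rule mat_bracket_power_swap[symmetric]) (simp add: ab bS cB)
      then show ?thesis using W[OF Z(2)[OF c]] by simp
    qed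
    moreover have "\<exists>k. (mat_bracket c ^^ k) Z' = 0" if c: "c \<in> S" for c
    proof -
      have cB: "c \<in> B" using c S(2) by auto
      obtain k where "(mat_bracket c ^^ k) Z = 0" using Z(3)[OF c] by blast
      moreover have "(mat_bracket c ^^ k) Z' = (mat_bracket b ^^ r) ((mat_bracket c ^^ k) Z)"
        unfolding Z'_def by (rule mat_bracket_power_power_swap) (simp add: ab bS cB)
      ultimately have "(mat_bracket c ^^ k) Z' = 0" by simp
      then show ?thesis by blast
    qed
    ultimately show ?case by auto
  qed
  from this[OF S(1) subset_refl] norm show False by blast
qed

text \<open>A real vector space is not a finite union of proper subspaces: along the line
  \<open>M + t *\<^sub>R b\<close> each of the linear maps vanishes for at most one
  \<open>t\<close>.\<close>

lemma generic_element:
  fixes f :: "'i \<Rightarrow> 'a::real_vector \<Rightarrow> 'b::real_vector"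
  assumes V: "subspace V" and "finite D" "\<And>d. d \<in> D \<Longrightarrow> linear (f d)"
    "\<And>d. d \<in> D \<Longrightarrow> \<exists>b\<in>V. f d b \<noteq> 0"
  shows "\<exists>M\<in>V. \<forall>d\<in>D. f d M \<noteq> 0"
  using assms(2-4)
proof (induction D rule: finite_induct)
  case empty
  then show ?case using subspace_0[OF V] by blast
next
  case (insert e D)
  then obtain M where M: "M \<in> V" "\<And>d. d \<in> D \<Longrightarrow> f d M \<noteq> 0" by auto
  obtain b where b: "b \<in> V" "f e b \<noteq> 0" using insert.prems by auto
  have fin: "finite {t :: real. f d M + t *\<^sub>R f d b = 0}" if "f d M \<noteq> 0 \<or> f d b \<noteq> 0" for d
  proof -
    have "s = t" if st: "f d M + s *\<^sub>R f d b = 0" "f d M + t *\<^sub>R f d b = 0" for s t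
    proof (rule ccontr)
      assume "s \<noteq> t"
      have "(s - t) *\<^sub>R f d b = (f d M + s *\<^sub>R f d b) - (f d M + t *\<^sub>R f d b)"
        by (simp add: algebra_simps)
      then have "f d b = 0" using st \<open>s \<noteq> t\<close> by simp
      then show False using st \<open>f d M \<noteq> 0 \<or> f d b \<noteq> 0\<close> by simp
    qed
    then have "{t. f d M + t *\<^sub>R f d b = 0} \<subseteq> {SOME t. f d M + t *\<^sub>R f d b = 0}"
      by (auto intro: someI2)
    then show ?thesis using finite_subset by blast
  qed
  have "finite (\<Union>d\<in>insert e D. {t :: real. f d M + t *\<^sub>R f d b = 0})"
    using insert.hyps M b by (intro finite_UN_I fin) auto
  then obtain t :: real where t: "t \<notin> (\<Union>d\<in>insert e D. {t. f d M + t *\<^sub>R f d b = 0})"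
    using ex_new_if_finite infinite_UNIV_char_0 by blast
  have "f d (M + t *\<^sub>R b) \<noteq> 0" if "d \<in> insert e D" for d
    using t that insert.prems(1)[OF that] by (auto simp: linear_add linear_scale)
  moreover have "M + t *\<^sub>R b \<in> V" using V M b by (simp add: subspace_add subspace_scale)
  ultimately show ?case by blast
qed

text \<open>The matrices \<open>u \<phi>\<^sup>T\<close> and \<open>u' \<phi>\<^sup>T\<close> commute; comparing the two products gives
  \<open>(\<phi> \<cdot> u') u = (\<phi> \<cdot> u) u'\<close>.\<close>

lemma weight_vectors_proportional:
  fixes B :: "(real^'n^'n) set"
  assumes S: "finite S" "S \<subseteq> B" and B: "subspace B"
    and ab: "\<And>X Y. X \<in> B \<Longrightarrow> Y \<in> B \<Longrightarrow> mat_bracket X Y = 0"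
    and norm: "\<And>X. (\<And>b. b \<in> S \<Longrightarrow> mat_bracket b X \<in> B) \<Longrightarrow> X \<in> B"
    and u: "weight_vector (cmat ` S) \<theta> u" and u': "weight_vector (cmat ` S) \<theta> u'" "u' \<noteq> 0"
  shows "\<exists>c. u = c *s u'"
proof -
  have comm: "b ** c = c ** b" if "b \<in> S" "c \<in> S" for b c
    using ab[of b c] that S(2) by (auto simp: mat_bracket_def)
  let ?T = "transpose ` cmat ` S"
  have "vec.span {w. \<exists>\<theta>. weight_vector ?T \<theta> w} = UNIV"
  proof (rule weight_vectors_span)
    fix b c assume "b \<in> ?T" "c \<in> ?T"
    then obtain b' c' where "b' \<in> S" "c' \<in> S" "b = transpose (cmat b')" "c = transpose (cmat c')"
      by auto
    then show "b ** c = c ** b" using comm[of b' c'] by (metis cmat_mult matrix_transpose_mul)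
  qed (use S in simp)
  moreover have "vec.subspace {\<phi>. cdot \<phi> u' = 0}"
    by (rule vec.subspaceI) (simp_all add: cdot_linear)
  moreover have "\<exists>\<phi>. cdot \<phi> u' \<noteq> 0"
  proof -
    obtain j where "u' $ j \<noteq> 0" using u'(2) by (auto simp: vec_eq_iff)
    then have "cdot (axis j 1) u' \<noteq> 0" by (simp add: cdot_def axis_def if_distribR if_distrib cong: if_cong)
    then show ?thesis by blast
  qed
  \<comment> \<open>Covectors vanishing on \<open>u'\<close> form a proper subspace, while weight
    covectors span. So some weight covector pairs nontrivially with \<open>u'\<close>, which forces
    its weight to be \<theta> on the matrices of \<open>S\<close>.\<close>
  ultimately have "\<not> {w. \<exists>\<theta>. weight_vector ?T \<theta> w} \<subseteq> {\<phi>. cdot \<phi> u' = 0}"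
    using vec.span_minimal by blast
  then obtain \<phi> \<psi> where \<phi>: "weight_vector ?T \<psi> \<phi>" "cdot \<phi> u' \<noteq> 0" by blast
  have eq: "\<psi> (transpose b) = \<theta> b" if "b \<in> cmat ` S" for b
    using cdot_weight_vectors[OF u'(1) \<phi>(1) that] \<phi>(2) by blast
  have inB: "Re_mat (outer w \<phi>) \<in> B \<and> Im_mat (outer w \<phi>) \<in> B" if w: "weight_vector (cmat ` S) \<theta> w" for w
  proof -
    have nil: "\<exists>k. (cad (cmat b) ^^ k) (outer w \<phi>) = 0" if b: "b \<in> S" for b
    proof -
      obtain k where "poly_act ([:- \<theta> (cmat b), 1:] ^ k) (cmat b) w = 0"
        using w b unfolding weight_vector_def by blast
      moreover obtain l where "poly_act ([:- \<theta> (cmat b), 1:] ^ l) (transpose (cmat b)) \<phi> = 0"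
        using \<phi>(1) b eq[of "cmat b"] unfolding weight_vector_def by (metis imageI)
      ultimately show ?thesis using cad_outer_nilpotent by blast
    qed
    have "\<exists>k. (mat_bracket b ^^ k) (Re_mat (outer w \<phi>)) = 0"
      "\<exists>k. (mat_bracket b ^^ k) (Im_mat (outer w \<phi>)) = 0" if b: "b \<in> S" for b
    proof -
      obtain k where k: "(cad (cmat b) ^^ k) (outer w \<phi>) = 0" using nil[OF b] by blast
      have "Re_mat (0 :: complex^'n^'n) = 0" "Im_mat (0 :: complex^'n^'n) = 0" by (simp_all add: vec_eq_iff)
      then show "\<exists>k. (mat_bracket b ^^ k) (Re_mat (outer w \<phi>)) = 0"
        "\<exists>k. (mat_bracket b ^^ k) (Im_mat (outer w \<phi>)) = 0"
        using cad_power_cmat[of k b "outer w \<phi>"] k by metis+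
    qed
    then show ?thesis
      using self_normalizing_engel[OF S B ab norm] by blast
  qed
  have cB: "X ** Y = Y ** X" if "X \<in> B" "Y \<in> B" for X Y
    using ab[OF that] by (simp add: mat_bracket_def)
  have comm': "outer u \<phi> ** outer u' \<phi> = outer u' \<phi> ** outer u \<phi>"
    using inB[OF u] inB[OF u'(1)] by (intro commute_from_parts cB) auto
  have "\<phi> \<noteq> 0" using \<phi>(2) by (auto simp: cdot_linear)
  then obtain j where j: "\<phi> $ j \<noteq> 0" by (auto simp: vec_eq_iff)
  have "cdot \<phi> u' * u $ i = cdot \<phi> u * u' $ i" for i
    using arg_cong[OF comm', of "\<lambda>Y. Y $ i $ j"] j unfolding outer_outer_nth by simp
  then have "u = (cdot \<phi> u / cdot \<phi> u') *s u'"
    using \<phi>(2) by (simp add: vec_eq_iff field_simps)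
  then show ?thesis by blast
qed

lemma self_normalizing_regular_element:
  fixes B :: "(real^'n^'n) set"
  assumes B: "subspace B"
    and ab: "\<And>X Y. X \<in> B \<Longrightarrow> Y \<in> B \<Longrightarrow> mat_bracket X Y = 0"
    and norm: "\<And>X. (\<And>b. b \<in> B \<Longrightarrow> mat_bracket b X \<in> B) \<Longrightarrow> X \<in> B"
  shows "\<exists>M\<in>B. card (complex_eigenvalues UNIV ((*v) M)) = CARD('n)"
proof -
  \<comment> \<open>A basis supplies the finite family that the inductions over weights and over
    Engel's argument require; linearity transfers the normalizer condition from \<open>S\<close> to
    \<open>B\<close>.\<close>
  obtain S where S: "S \<subseteq> B" "independent S" "B \<subseteq> span S"
    by (rule maximal_independent_subset)
  have finS: "finite S" using S(2) by (rule independent_imp_finite)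
  have spanS: "span S = B" using S B by (simp add: span_subspace)
  have normS: "X \<in> B" if X: "\<And>b. b \<in> S \<Longrightarrow> mat_bracket b X \<in> B" for X
  proof (rule norm)
    fix b assume "b \<in> B"
    then have "b \<in> span S" using spanS by simp
    then show "mat_bracket b X \<in> B"
      by (induction rule: span_induct_alt)
        (auto simp: mat_bracket_simps intro!: subspace_0 subspace_add subspace_scale B X)
  qed
  note proportional = weight_vectors_proportional[OF finS S(1) B ab normS]
  have comm: "b ** c = c ** b" if mem: "b \<in> cmat ` S" "c \<in> cmat ` S" for b c
  proof -
    obtain b' c' where bc: "b = cmat b'" "c = cmat c'" "b' \<in> S" "c' \<in> S" using mem by auto
    have "b' ** c' = c' ** b'"
      using ab[of b' c'] bc S(1) by (auto simp: mat_bracket_def)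
    then show ?thesis unfolding bc by (metis cmat_mult)
  qed
  have span: "vec.span {w. \<exists>\<theta>. weight_vector (cmat ` S) \<theta> w} = UNIV"
    by (intro weight_vectors_span comm) (simp_all add: finS)
  obtain W where W: "W \<subseteq> {w. \<exists>\<theta>. weight_vector (cmat ` S) \<theta> w}" "vec.independent W"
    "{w. \<exists>\<theta>. weight_vector (cmat ` S) \<theta> w} \<subseteq> vec.span W"
    by (rule vec.maximal_independent_subset)
  have "vec.span W = UNIV" using W(3) span by (metis top.extremum_uniqueI vec.span_minimal vec.subspace_span)
  then have "card W = CARD('n)" using vec.dim_eq_card_independent[OF W(2)] vec.dim_span[of W]
    by (metis vec_dim_card)
  moreover have finW: "finite W" using W(2) by (rule vec.finiteI_independent) 
  ultimately obtain u where u: "bij_betw u (UNIV :: 'n set) W"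
    by (metis finite finite_same_card_bij)
  have uW: "u i \<in> W" for i using u by (auto simp: bij_betw_def)
  have u0: "u i \<noteq> 0" for i using uW W(2) vec.dependent_zero by metis
  \<comment> \<open>The image of \<open>u i\<close> under \<open>b\<close> has the same weight,
    hence is proportional to \<open>u i\<close>: generalized eigenvectors turn out to be
    eigenvectors.\<close>
  have ex: "\<exists>e. cmat b *v u i = e *s u i" if b: "b \<in> S" for i b
  proof -
    obtain \<theta> where "weight_vector (cmat ` S) \<theta> (u i)" using uW W(1) by blast
    moreover from this have "weight_vector (cmat ` S) \<theta> (cmat b *v u i)"
      by (rule weight_vector_mult) (use comm b in auto)
    ultimately show ?thesis using proportional u0 by blast
  qed
  define e where "e i b = (SOME c. cmat b *v u i = c *s u i)" for i b
  have e: "cmat b *v u i = e i b *s u i" if b: "b \<in> S" for i b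
    unfolding e_def by (rule someI_ex[OF ex[OF b]])
  have distinct: "\<exists>b\<in>S. e i b \<noteq> e k b" if ik: "i \<noteq> k" for i k
  proof (rule ccontr)
    assume *: "\<not> (\<exists>b\<in>S. e i b \<noteq> e k b)"
    \<comment> \<open>Weights take complex matrices while \<open>e\<close> takes real ones;
      \<open>Re_mat\<close> undoes \<open>cmat\<close>.\<close>
    define \<theta> where "\<theta> b = e i (Re_mat b)" for b
    have th: "\<theta> (cmat b) = e i b" for b
    proof -
      have "Re_mat (cmat b) = b" by (simp add: vec_eq_iff)
      then show ?thesis by (simp add: \<theta>_def)
    qed
    have "weight_vector (cmat ` S) \<theta> (u l)" if l: "l = i \<or> l = k" for l
      unfolding weight_vector_def
    proof clarify
      fix b assume b: "b \<in> S"
      then have "cmat b *v u l = \<theta> (cmat b) *s u l" using e[OF b] * l th by auto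
      then have "poly_act ([:- \<theta> (cmat b), 1:] ^ 1) (cmat b) (u l) = 0"
        by (simp add: vec.scale_minus_left)
      then show "\<exists>k. poly_act ([:- \<theta> (cmat b), 1:] ^ k) (cmat b) (u l) = 0" by blast
    qed
    then obtain c where c: "u i = c *s u k" using proportional u0 by blast
    have "u i \<noteq> u k" using u ik by (auto simp: bij_betw_def inj_on_def)
    then have "u i \<in> vec.span (W - {u i})"
      unfolding c using uW[of k] by (intro vec.span_scale vec.span_base) (auto simp: c)
    then show False using W(2) uW[of i] by (auto simp: vec.dependent_def)
  qed
  have "\<exists>j. u i $ j \<noteq> 0" for i using u0[of i] by (auto simp: vec_eq_iff)
  then obtain j where j: "\<And>i. u i $ j i \<noteq> 0" by metis
  \<comment> \<open>Reading the eigenvalue off a fixed nonzero coordinate of \<open>u i\<close>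
    gives a map that is linear on all matrices, as \<open>generic_element\<close> demands.\<close>
  define E where "E i M = (cmat M *v u i) $ j i / u i $ j i" for i and M :: "real^'n^'n"
  have linE: "linear (E i)" for i
    by (intro linearI) (simp_all add: E_def cmat_add cmat_scaleR scaleR_matrix_vector_mult
        matrix_vector_mult_add_rdistrib add_divide_distrib scaleR_conv_of_real[where 'a = complex])
  have ES: "E i b = e i b" if "b \<in> S" for i b using e[OF that] j by (simp add: E_def)
  have eig: "cmat M *v u i = E i M *s u i" if "M \<in> B" for i M
  proof -
    have "M \<in> span S" using that spanS by simp
    then show ?thesis
    proof (induction rule: span_induct_alt)
      case base
      then show ?case by (simp add: E_def)
    next
      case (step c x y)
      have "E i (c *\<^sub>R x + y) = of_real c * E i x + E i y"
        using linE[of i] by (simp add: linear_add linear_scale scaleR_conv_of_real[where 'a = complex])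
      then show ?case
        using step e[OF step(1)] ES[OF step(1)]
        by (simp add: cmat_add cmat_scaleR scaleR_matrix_vector_mult matrix_vector_mult_add_rdistrib
            vec.scale_left_distrib)
    qed
  qed
  define f where "f d M = E (fst d) M - E (snd d) M" for d M
  have "\<exists>M\<in>B. \<forall>d\<in>{d. fst d \<noteq> snd d}. f d M \<noteq> 0"
  proof (rule generic_element[OF B])
    show "linear (f d)" for d unfolding f_def by (intro linear_compose_sub linE)
    fix d :: "'n \<times> 'n" assume "d \<in> {d. fst d \<noteq> snd d}"
    then obtain b where "b \<in> S" "e (fst d) b \<noteq> e (snd d) b" using distinct by blast
    then show "\<exists>b\<in>B. f d b \<noteq> 0" using S(1) by (auto simp: f_def ES intro!: bexI[of _ b])
  qed simp
  then obtain M where M: "M \<in> B" "\<And>i k. i \<noteq> k \<Longrightarrow> E i M \<noteq> E k M" by (auto simp: f_def)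
  have "inj (\<lambda>i. E i M)" using M(2) by (auto simp: inj_on_def)
  then have "card (range (\<lambda>i. E i M)) = CARD('n)" by (rule card_image)
  moreover have "range (\<lambda>i. E i M) \<subseteq> complex_eigenvalues UNIV ((*v) M)"
    using eig[OF M(1)] u0 unfolding complex_eigenvalues_iff subset_iff by blast
  moreover have "finite (complex_eigenvalues UNIV ((*v) M)) \<and>
      card (complex_eigenvalues UNIV ((*v) M)) \<le> CARD('n)"
    by (rule card_eigenvalues_le) (auto simp: complex_eigenvalues_iff)
  ultimately have "card (complex_eigenvalues UNIV ((*v) M)) = CARD('n)"
    using card_mono by (metis le_antisym)
  then show ?thesis using M(1) by blast
qed

section \<open>Matrices with distinct eigenvalues\<close>

text \<open>Complex conjugation permutes the eigenvectors \<open>v i\<close> by \<open>sg\<close>; the rows of \<open>Q\<close> are the dual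
  basis.\<close>

locale eigenbasis =
  fixes M :: "real^'n^'n" and lam :: "'n \<Rightarrow> complex" and v :: "'n \<Rightarrow> complex^'n"
    and sg :: "'n \<Rightarrow> 'n" and Q :: "complex^'n^'n"
  assumes inj_lam: "inj lam"
    and eig: "cmat M *v v i = lam i *s v i"
    and lam_sg: "lam (sg i) = cnj (lam i)"
    and v_sg: "v (sg i) = cnj_vec (v i)"
    and dual: "(Q *v v j) $ i = (if i = j then 1 else 0)"
    and expand: "(\<Sum>i\<in>UNIV. (Q *v w) $ i *s v i) = w"

text \<open>Eigenvectors are chosen compatibly with conjugation: real ones for real eigenvalues, any
  for the upper half-plane, and the conjugates of the latter for the lower half-plane.
  \<open>Q\<close> inverts the matrix that has them as columns.\<close>

lemma eigenbasis_exists: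
  fixes M :: "real^'n^'n"
  assumes card: "card (complex_eigenvalues UNIV ((*v) M)) = CARD('n)"
  shows "\<exists>lam v sg Q. eigenbasis M lam v sg Q"
proof -
  let ?E = "complex_eigenvalues UNIV ((*v) M)"
  have fin: "finite ?E" using card by (metis card.infinite zero_less_card_finite less_irrefl)
  obtain lam :: "'n \<Rightarrow> complex" where lam: "bij_betw lam UNIV ?E"
    using finite_same_card_bij[of "UNIV :: 'n set" ?E] card fin by auto
  have cnj_eig: "cmat M *v cnj_vec w = cnj z *s cnj_vec w" if "cmat M *v w = z *s w" for z w
    using that by (metis cnj_vec_cmat cnj_vec_smult)
  have "\<exists>V. V \<noteq> 0 \<and> cmat M *v V = z *s V \<and> (Im z = 0 \<longrightarrow> cnj_vec V = V)" if z: "z \<in> ?E" for z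
  proof -
    obtain w where w: "w \<noteq> 0" "cmat M *v w = z *s w" using z by (auto simp: complex_eigenvalues_iff)
    show ?thesis
    proof (cases "Im z = 0")
      case True
      \<comment> \<open>For a real eigenvalue the real and imaginary parts of \<open>w\<close>
        satisfy the same equation, and one of them is nonzero.\<close>
      have *: "cmat M *v cvec (Re_vec w) = z *s cvec (Re_vec w)"
        "cmat M *v cvec (Im_vec w) = z *s cvec (Im_vec w)"
        using w(2) True unfolding eigen_decomposition cmat_mult_cvec
        by (auto simp: vec_eq_iff complex_eq_iff)
      have "Re_vec w \<noteq> 0 \<or> Im_vec w \<noteq> 0" using w(1) by (auto simp: vec_eq_iff complex_eq_iff)
      then have "cvec (Re_vec w) \<noteq> 0 \<or> cvec (Im_vec w) \<noteq> 0" by (metis cvec_0 cvec_inject)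
      with * show ?thesis using cnj_vec_cvec by metis
    qed (use w in blast)
  qed
  then obtain V0 where V0: "\<And>z. z \<in> ?E \<Longrightarrow> V0 z \<noteq> 0" "\<And>z. z \<in> ?E \<Longrightarrow> cmat M *v V0 z = z *s V0 z"
    "\<And>z. z \<in> ?E \<Longrightarrow> Im z = 0 \<Longrightarrow> cnj_vec (V0 z) = V0 z" by metis
  define V where "V z = (if Im z \<ge> 0 then V0 z else cnj_vec (V0 (cnj z)))" for z
  have cnjE: "cnj z \<in> ?E" if "z \<in> ?E" for z
    using that cnj_eig unfolding complex_eigenvalues_iff by (metis cnj_vec_eq_0)
  have V: "V z \<noteq> 0" "cmat M *v V z = z *s V z" if "z \<in> ?E" for z
    using V0[OF that] V0[OF cnjE[OF that]] cnj_eig[OF V0(2)[OF cnjE[OF that]]] by (auto simp: V_def)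
  have V_cnj: "V (cnj z) = cnj_vec (V z)" if "z \<in> ?E" for z
  proof (cases "Im z = 0")
    case True
    then have "cnj z = z" by (simp add: complex_eq_iff)
    then show ?thesis using V0(3)[OF that True] True by (simp add: V_def)
  qed (auto simp: V_def)
  have lamE: "lam i \<in> ?E" for i using lam by (auto simp: bij_betw_def)
  have inj: "inj lam" using lam by (simp add: bij_betw_def)
  define v where "v i = V (lam i)" for i
  define sg where "sg i = inv lam (cnj (lam i))" for i
  have lam_sg: "lam (sg i) = cnj (lam i)" for i
    unfolding sg_def using cnjE[OF lamE] lam by (intro f_inv_into_f) (auto simp: bij_betw_def)
  define P where "P = (\<chi> k i. v i $ k)"
  have Pw: "P *v w = (\<Sum>i\<in>UNIV. w $ i *s v i)" for w
    by (simp add: P_def vec_eq_iff matrix_vector_mult_def mult.commute)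
  have "w = 0" if "P *v w = 0" for w
  proof -
    have "(\<Sum>z\<in>?E. w $ inv lam z *s V z) = (\<Sum>i\<in>UNIV. w $ i *s v i)"
      using sum.reindex_bij_betw[OF lam, of "\<lambda>z. w $ inv lam z *s V z"] inj by (simp add: v_def)
    also have "\<dots> = 0" using that by (simp add: Pw)
    finally have "w $ inv lam z = 0" if "z \<in> ?E" for z
      using eigenvectors_independent[of ?E "cmat M" V "\<lambda>z. w $ inv lam z"] V fin that by blast
    from this[OF lamE] have "w $ i = 0" for i using inj by simp
    then show ?thesis by (simp add: vec_eq_iff)
  qed
  then obtain Q where Q: "Q ** P = mat 1"
    using matrix_left_invertible_ker[of P] by blast
  then have Q': "P ** Q = mat 1" by (simp add: matrix_left_right_inverse)
  have "eigenbasis M lam v sg Q"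
  proof
    show "inj lam" by fact
    show "cmat M *v v i = lam i *s v i" for i unfolding v_def by (rule V(2)[OF lamE])
    show "lam (sg i) = cnj (lam i)" for i by fact
    then show "v (sg i) = cnj_vec (v i)" for i unfolding v_def by (simp add: V_cnj[OF lamE])
    show "(Q *v v j) $ i = (if i = j then 1 else 0)" for i j
    proof -
      have "v j = P *v axis j 1"
        by (simp add: Pw axis_def vec_eq_iff if_distrib if_distribR cong: if_cong)
      then have "Q *v v j = axis j 1" by (simp add: matrix_vector_mul_assoc Q)
      then show ?thesis by (simp add: axis_def)
    qed
    show "(\<Sum>i\<in>UNIV. (Q *v w) $ i *s v i) = w" for w
      by (simp add: matrix_vector_mul_assoc Q' flip: Pw)
  qed
  then show ?thesis by blast
qed

text \<open>Taking real parts of coefficients averages \<open>q\<close> with its conjugate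
  polynomial. If \<open>q\<close> has conjugate values at conjugate nodes, these values survive, so
  complex interpolation produces a real polynomial.\<close>

lemma poly_map_of_real_Re:
  "poly (map_poly (\<lambda>a. complex_of_real (Re a)) q) x = (poly q x + cnj (poly q (cnj x))) / 2"
proof (induction q)
  case (pCons a q)
  have "complex_of_real (Re a) = (a + cnj a) / 2" by (simp add: complex_eq_iff)
  with pCons show ?case by (simp add: map_poly_pCons field_simps)
qed simp

lemma interpolation:
  fixes l z :: "'i::finite \<Rightarrow> complex"
  assumes "inj l"
  shows "\<exists>q. \<forall>i. poly q (l i) = z i"
proof -
  define q where "q = (\<Sum>i\<in>UNIV. smult (z i / (\<Prod>j\<in>-{i}. l i - l j)) (\<Prod>j\<in>-{i}. [:- l j, 1:]))"
  have "poly q (l k) = z k" for k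
  proof -
    have nz: "(\<Prod>j\<in>-{k}. l k - l j) \<noteq> 0" using assms by (auto simp: inj_eq)
    have "poly q (l k) = (\<Sum>i\<in>UNIV. z i / (\<Prod>j\<in>-{i}. l i - l j) * (\<Prod>j\<in>-{i}. l k - l j))"
      by (simp add: q_def poly_sum poly_prod)
    also have "\<dots> = (\<Sum>i\<in>{k}. z i / (\<Prod>j\<in>-{i}. l i - l j) * (\<Prod>j\<in>-{i}. l k - l j))"
      by (intro sum.mono_neutral_right) auto
    finally show ?thesis using nz by simp
  qed
  then show ?thesis by blast
qed

section \<open>Diagonal form of the centralizer of \<open>M\<close>\<close>

context eigenbasis
begin

definition co :: "'n \<Rightarrow> complex^'n \<Rightarrow> complex" where
  "co i w = (Q *v w) $ i"

text \<open>The diagonal entries of \<open>X\<close> in the eigenbasis. For \<open>X\<close>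
  commuting with \<open>M\<close> they are its eigenvalues (\<open>commute_dg\<close>).\<close>

definition dg :: "real^'n^'n \<Rightarrow> 'n \<Rightarrow> complex" where
  "dg X i = co i (cmat X *v v i)"

text \<open>The reality condition: it holds for the diagonal entries of real matrices
  (\<open>sym_dg\<close>) and for the coordinates of real vectors (\<open>sym_co\<close>).\<close>

definition sym :: "('n \<Rightarrow> complex) \<Rightarrow> bool" where
  "sym z \<longleftrightarrow> (\<forall>i. z (sg i) = cnj (z i))"

lemma co_v [simp]: "co i (v j) = (if i = j then 1 else 0)"
  by (simp add: co_def dual)

lemma co_simps: "co i (u + w) = co i u + co i w" "co i (u - w) = co i u - co i w"
  "co i (c *s w) = c * co i w" "co i 0 = 0"
  by (simp_all add: co_def vec.add vec.diff vec.scale)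

lemma co_sum: "co i (\<Sum>j\<in>J. f j) = (\<Sum>j\<in>J. co i (f j))"
  by (induction J rule: infinite_finite_induct) (simp_all add: co_simps)

lemma co_expand: "(\<Sum>i\<in>UNIV. co i w *s v i) = w"
  by (simp add: co_def expand)

lemma co_eqI: "(\<And>i. co i u = co i w) \<Longrightarrow> u = w"
  by (metis (no_types, lifting) co_expand sum.cong)

lemma co_sum_v: "co i (\<Sum>j\<in>UNIV. c j *s v j) = c i"
  by (simp add: co_sum co_simps if_distrib cong: if_cong)

lemma matrix_eq_on_basis:
  assumes "\<And>i. A *v v i = A' *v v i"
  shows "A = A'"
proof -
  have "A *v w = A' *v w" for w
  proof -
    have "A *v w = (\<Sum>i\<in>UNIV. co i w *s (A *v v i))"
      by (subst co_expand[of w, symmetric]) (simp add: vec.sum vec.scale)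
    also have "\<dots> = A' *v w"
      by (subst (2) co_expand[of w, symmetric]) (simp add: vec.sum vec.scale assms)
    finally show ?thesis .
  qed
  then show ?thesis by (simp add: matrix_eq)
qed

lemma real_matrix_eq_on_basis:
  "(\<And>i. cmat A *v v i = cmat A' *v v i) \<Longrightarrow> A = A'"
  using matrix_eq_on_basis[of "cmat A" "cmat A'"] by simp

lemma sg_sg [simp]: "sg (sg i) = i"
  by (rule injD[OF inj_lam]) (simp add: lam_sg)

lemma sg_eq_iff [simp]: "sg i = sg j \<longleftrightarrow> i = j"
  by (metis sg_sg)

lemma bij_sg: "bij sg"
  by (rule involuntory_imp_bij) simp

lemma co_cnj: "co (sg i) (cnj_vec w) = cnj (co i w)"
proof -
  have "cnj_vec w = (\<Sum>i\<in>UNIV. cnj (co i w) *s v (sg i))"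
    by (subst co_expand[of w, symmetric]) (simp add: cnj_vec_sum cnj_vec_smult v_sg)
  then have "co (sg i) (cnj_vec w) = (\<Sum>j\<in>UNIV. cnj (co j w) * (if i = j then 1 else 0))"
    by (simp add: co_sum co_simps)
  then show ?thesis by (simp add: if_distrib cong: if_cong)
qed

lemma co_M: "co i (cmat M *v w) = lam i * co i w"
proof -
  have "cmat M *v w = (\<Sum>i\<in>UNIV. (lam i * co i w) *s v i)"
    by (subst co_expand[of w, symmetric]) (simp add: vec.sum vec.scale eig mult.commute)
  then show ?thesis by (simp add: co_sum_v)
qed

text \<open>In coordinates the equation says that lam j - lam i annihilates \<open>co j w\<close>,
  and the eigenvalues are distinct.\<close>

lemma eigenvector_M:
  assumes "cmat M *v w = lam i *s w"
  shows "w = co i w *s v i"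
proof (rule co_eqI)
  fix j
  have "lam j * co j w = lam i * co j w" using assms by (simp only: co_simps flip: co_M)
  then have "j \<noteq> i \<Longrightarrow> co j w = 0" using inj_lam by (auto dest: injD)
  then show "co j w = co j (co i w *s v i)" by (auto simp: co_simps)
qed

lemma commute_dg:
  assumes "X ** M = M ** X"
  shows "cmat X *v v i = dg X i *s v i"
  unfolding dg_def
proof (rule eigenvector_M)
  have "cmat M *v (cmat X *v v i) = cmat X *v (cmat M *v v i)"
    using assms by (metis cmat_mult matrix_vector_mul_assoc)
  then show "cmat M *v (cmat X *v v i) = lam i *s (cmat X *v v i)"
    by (simp add: eig vec.scale)
qed

lemma dg_eqI: "cmat X *v v i = c *s v i \<Longrightarrow> dg X i = c"
  by (simp add: dg_def co_simps)

lemma sym_dg: "sym (dg X)"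
  unfolding sym_def dg_def by (metis cnj_vec_cmat co_cnj v_sg)

lemma poly_algebra_commute: "X \<in> poly_algebra M \<Longrightarrow> X ** M = M ** X"
  using mat_poly_commute[of M M] by (auto simp: poly_algebra_def)

text \<open>The eigenvalues are distinct, so a complex polynomial takes the values
  \<open>z i\<close> there; symmetry of \<open>z\<close> allows its coefficients to be replaced by
  their real parts.\<close>

lemma poly_algebra_interpolation:
  assumes "sym z"
  shows "\<exists>X\<in>poly_algebra M. \<forall>i. cmat X *v v i = z i *s v i"
proof -
  obtain q where q: "\<And>i. poly q (lam i) = z i" using interpolation[OF inj_lam, of z] by blast
  define r where "r = map_poly Re q"
  have r: "map_poly of_real r = map_poly (\<lambda>a. complex_of_real (Re a)) q"
    by (simp add: r_def map_poly_map_poly o_def)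
  have "poly (map_poly of_real r) (lam i) = z i" for i
    unfolding r poly_map_of_real_Re lam_sg[symmetric] q using assms by (simp add: sym_def)
  then have "\<forall>i. cmat (mat_poly r M) *v v i = z i *s v i"
    by (simp add: cmat_mat_poly poly_act_eigenvector[OF eig])
  then show ?thesis by (auto simp: poly_algebra_def)
qed

text \<open>A matrix commuting with \<open>M\<close> preserves the eigenlines of \<open>M\<close>;
  interpolation finds a polynomial in \<open>M\<close> with the same, necessarily symmetric,
  diagonal entries.\<close>

lemma centralizer_eq_poly_algebra: "X ** M = M ** X \<longleftrightarrow> X \<in> poly_algebra M"
proof
  assume X: "X ** M = M ** X"
  obtain Y where "Y \<in> poly_algebra M" "\<And>i. cmat Y *v v i = dg X i *s v i"
    using poly_algebra_interpolation[OF sym_dg] by blast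
  moreover from this have "X = Y" by (intro real_matrix_eq_on_basis) (simp add: commute_dg[OF X])
  ultimately show "X \<in> poly_algebra M" by simp
qed (rule poly_algebra_commute)

lemma poly_algebra_v: "X \<in> poly_algebra M \<Longrightarrow> cmat X *v v i = dg X i *s v i"
  by (rule commute_dg[OF poly_algebra_commute])

lemma poly_algebra_eqI:
  "X \<in> poly_algebra M \<Longrightarrow> Y \<in> poly_algebra M \<Longrightarrow> (\<And>i. dg X i = dg Y i) \<Longrightarrow> X = Y"
  by (rule real_matrix_eq_on_basis) (simp add: poly_algebra_v)

lemma commute_poly_algebra:
  assumes "X \<in> poly_algebra M" "Y \<in> poly_algebra M"
  shows "X ** Y = Y ** X"
  by (rule real_matrix_eq_on_basis)
    (simp add: cmat_mult poly_algebra_v assms vec.scale mult.commute flip: matrix_vector_mul_assoc)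

lemma trace_dg: "complex_of_real (trace X) = (\<Sum>i\<in>UNIV. dg X i)"
proof -
  define P where "P = (\<chi> k i. v i $ k)"
  have P: "P *v w = (\<Sum>i\<in>UNIV. w $ i *s v i)" for w
    by (simp add: P_def vec_eq_iff matrix_vector_mult_def mult.commute)
  have "(P ** Q) *v w = mat 1 *v w" for w
    by (simp add: P expand flip: matrix_vector_mul_assoc)
  then have PQ: "P ** Q = mat 1" by (simp add: matrix_eq)
  have "(\<Sum>i\<in>UNIV. dg X i) = trace (Q ** (cmat X ** P))"
    by (simp add: trace_def dg_def co_def matrix_matrix_mult_def matrix_vector_mult_def P_def)
  also have "\<dots> = trace (cmat X ** (P ** Q))"
    by (subst trace_mul_sym) (simp add: matrix_mul_assoc)
  also have "\<dots> = complex_of_real (trace X)" by (simp add: PQ trace_def)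
  finally show ?thesis by simp
qed

text \<open>Diagonalization over the ring of complex polynomials. \<open>C\<close> is the matrix x I
  - M, the constant matrix \<open>P\<close> of eigenvectors satisfies
  \<open>C ** P = P ** D\<close>, and \<open>det P\<close> is nonzero because \<open>R\<close>
  inverts \<open>P\<close>, so it cancels.\<close>

lemma map_poly_char_polynomial:
  "map_poly complex_of_real (char_polynomial M) = (\<Prod>i\<in>UNIV. [:- lam i, 1:])"
proof -
  \<comment> \<open>A ring homomorphism commutes with the determinant by the Leibniz formula; the
    following facts check sums, products and signs.\<close>
  define h where "h = (map_poly complex_of_real :: real poly \<Rightarrow> complex poly)"
  have h_add: "h (p + q) = h p + h q" for p q
    by (simp add: h_def poly_eq_iff coeff_map_poly)
  have h_mult: "h (p * q) = h p * h q" for p q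
    by (simp add: h_def poly_eq_iff coeff_map_poly coeff_mult)
  have h_1: "h 1 = 1" by (simp add: h_def)
  have h_0: "h 0 = 0" by (simp add: h_def)
  have h_minus: "h (- p) = - h p" for p by (simp add: h_def poly_eq_iff coeff_map_poly)
  have h_sum: "h (sum f A) = (\<Sum>x\<in>A. h (f x))" for f and A :: "('n \<Rightarrow> 'n) set"
    by (induction A rule: infinite_finite_induct) (simp_all add: h_add h_0)
  have h_prod: "h (prod f A) = (\<Prod>x\<in>A. h (f x))" for f and A :: "'n set"
    by (induction A rule: infinite_finite_induct) (simp_all add: h_mult h_1)
  have h_sign: "h (of_int (sign p)) = of_int (sign p)" for p :: "'n \<Rightarrow> 'n"
    by (simp add: sign_def h_1 h_minus)
  define C :: "complex poly^'n^'n"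
    where "C = (\<chi> i j. (if i = j then [:0, 1:] else 0) - [:cmat M $ i $ j:])"
  have "h (det A) = det (\<chi> i j. h (A $ i $ j))" for A :: "real poly^'n^'n"
    by (simp add: det_def h_sum h_mult h_prod h_sign)
  then have "h (char_polynomial M) =
      det (\<chi> i j. h ((if i = j then [:0, 1:] else 0) - [:M $ i $ j:]))"
    by (simp add: char_polynomial_def)
  also have "(\<chi> i j. h ((if i = j then [:0, 1:] else 0) - [:M $ i $ j:])) = C"
    by (simp add: C_def vec_eq_iff h_def map_poly_pCons)
  finally have hC: "h (char_polynomial M) = det C" .
  define P :: "complex poly^'n^'n" where "P = (\<chi> k i. [:v i $ k:])"
  define R :: "complex poly^'n^'n" where "R = (\<chi> k i. [:Q $ k $ i:])"
  define D :: "complex poly^'n^'n" where "D = (\<chi> i j. if i = j then [:- lam i, 1:] else 0)"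
  have const_sum: "(\<Sum>k\<in>UNIV. [:f k:]) = [:\<Sum>k\<in>UNIV. f k:]" for f :: "'n \<Rightarrow> complex"
    by (simp add: poly_eq_iff coeff_sum coeff_pCons split: nat.split)
  have "R ** P = mat 1"
    using dual by (simp add: R_def P_def matrix_matrix_mult_def matrix_vector_mult_def mat_def
        vec_eq_iff const_sum one_pCons mult.commute)
  then have "det R * det P = 1" by (metis det_I det_mul)
  then have detP: "det P \<noteq> 0" by auto
  have "C ** P = P ** D"
  proof -
    have "(\<Sum>k\<in>UNIV. C $ i $ k * P $ k $ j) = [:- lam j * v j $ i, v j $ i:]" for i j
    proof -
      have "(\<Sum>k\<in>UNIV. C $ i $ k * P $ k $ j) =
          (\<Sum>k\<in>UNIV. if i = k then [:0, v j $ k:] else 0) - (\<Sum>k\<in>UNIV. [:cmat M $ i $ k * v j $ k:])"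
        unfolding sum_subtractf[symmetric]
        by (intro sum.cong refl) (simp add: C_def P_def)
      also have "(\<Sum>k\<in>UNIV. [:cmat M $ i $ k * v j $ k:]) = [:(cmat M *v v j) $ i:]"
        by (simp only: const_sum matrix_vector_mult_def vec_lambda_beta)
      finally show ?thesis by (simp add: eig)
    qed
    moreover have "(\<Sum>k\<in>UNIV. P $ i $ k * D $ k $ j) = [:- lam j * v j $ i, v j $ i:]" for i j
      by (simp add: P_def D_def if_distrib cong: if_cong)
    ultimately show ?thesis by (simp add: matrix_matrix_mult_def vec_eq_iff)
  qed
  then have "det C * det P = det P * det D" by (metis det_mul)
  then have "det C = det D" using detP by simp
  also have "det D = (\<Prod>i\<in>UNIV. [:- lam i, 1:])"
    by (subst det_diagonal) (simp_all add: D_def)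
  finally show ?thesis using hC by (simp add: h_def)
qed

lemma mat_poly_v: "cmat (mat_poly p M) *v v i = poly (map_poly of_real p) (lam i) *s v i"
  by (simp add: cmat_mat_poly poly_act_eigenvector[OF eig])

lemma v_nonzero: "v i \<noteq> 0"
proof
  assume "v i = 0"
  then show False using co_v[of i i] by (simp add: co_simps del: co_v)
qed

lemma mat_poly_eq_0_degree:
  assumes "mat_poly q M = 0" "q \<noteq> 0"
  shows "CARD('n) \<le> degree q"
proof -
  let ?q = "map_poly complex_of_real q"
  have "poly ?q (lam i) = 0" for i
    using mat_poly_v[of q i] assms(1) v_nonzero[of i] by simp
  then have sub: "range lam \<subseteq> {x. poly ?q x = 0}" by auto
  have q0: "?q \<noteq> 0" using assms(2) by (simp add: map_poly_eq_0_iff)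
  have "CARD('n) = card (range lam)" using inj_lam by (simp add: card_image)
  also have "\<dots> \<le> card {x. poly ?q x = 0}" by (rule card_mono[OF poly_roots_finite[OF q0] sub])
  also have "\<dots> \<le> degree ?q" by (rule card_poly_roots_bound[OF q0])
  also have "\<dots> = degree q" by (simp add: degree_map_poly)
  finally show ?thesis .
qed

text \<open>The characteristic polynomial is monic of degree n and annihilates \<open>M\<close>
  because it vanishes at every eigenvalue. Every nonzero annihilator has the n eigenvalues as roots,
  so no smaller degree is possible.\<close>

lemma nonderogatory: "nonderogatory M"
proof -
  let ?c = "char_polynomial M"
  have deg: "degree ?c = CARD('n)"
  proof -
    have "degree (map_poly complex_of_real ?c) = degree ?c" by (simp add: degree_map_poly)
    then show ?thesis by (simp add: map_poly_char_polynomial degree_prod_sum_eq)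
  qed
  have "complex_of_real (lead_coeff ?c) = lead_coeff (map_poly complex_of_real ?c)"
    by (simp add: degree_map_poly coeff_map_poly)
  also have "\<dots> = 1" by (simp add: map_poly_char_polynomial lead_coeff_prod)
  finally have lead: "lead_coeff ?c = 1" by simp
  have zero: "mat_poly ?c M = 0"
  proof (rule real_matrix_eq_on_basis)
    fix i
    have "poly (\<Prod>i\<in>UNIV. [:- lam i, 1:]) (lam i) = 0" by (auto simp: poly_prod)
    then show "cmat (mat_poly ?c M) *v v i = cmat 0 *v v i"
      by (simp add: mat_poly_v map_poly_char_polynomial)
  qed
  have "min_polynomial M = ?c"
    unfolding min_polynomial_def
  proof (rule the_equality)
    show "lead_coeff ?c = 1 \<and> mat_poly ?c M = 0 \<and>
        (\<forall>q. q \<noteq> 0 \<and> mat_poly q M = 0 \<longrightarrow> degree ?c \<le> degree q)"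
      using lead zero deg mat_poly_eq_0_degree by auto
  next
    \<comment> \<open>Two monic annihilators of degree n differ by an annihilator of smaller degree,
      which must be 0.\<close>
    fix p assume p: "lead_coeff p = 1 \<and> mat_poly p M = 0 \<and>
        (\<forall>q. q \<noteq> 0 \<and> mat_poly q M = 0 \<longrightarrow> degree p \<le> degree q)"
    have p0: "p \<noteq> 0" using p by auto
    have c0: "?c \<noteq> 0" using lead by auto
    have degp: "degree p = degree ?c"
      using p p0 c0 zero mat_poly_eq_0_degree[of p] deg by (metis le_antisym)
    have "mat_poly (p - ?c) M = 0"
    proof -
      let ?N = "max (degree p) (degree ?c)"
      have "mat_poly (p - ?c) M = (\<Sum>k\<le>?N. coeff (p - ?c) k *\<^sub>R mat_pow M k)"
        by (intro mat_poly_upto degree_diff_le_max)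
      also have "\<dots> = mat_poly p M - mat_poly ?c M"
        by (subst (1 2) mat_poly_upto[where N = ?N])
          (simp_all add: sum_subtractf scaleR_left_diff_distrib)
      finally show ?thesis using p zero by simp
    qed
    show "p = ?c"
    proof (rule ccontr)
      assume "p \<noteq> ?c"
      then have "CARD('n) \<le> degree (p - ?c)"
        using \<open>mat_poly (p - ?c) M = 0\<close> by (intro mat_poly_eq_0_degree) auto
      moreover have "degree (p - ?c) < CARD('n)"
      proof -
        have "coeff (p - ?c) (CARD('n)) = 0" using p lead degp deg by simp
        moreover have "degree (p - ?c) \<le> CARD('n)"
          using degree_diff_le_max[of p ?c] degp deg by simp
        moreover have "lead_coeff (p - ?c) \<noteq> 0" unfolding leading_coeff_0_iff using \<open>p \<noteq> ?c\<close> by simp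
        ultimately show ?thesis by (metis le_neq_implies_less)
      qed
      ultimately show False by simp
    qed
  qed
  then show ?thesis by (simp add: nonderogatory_def)
qed

end

section \<open>Cartan subalgebras and the decomposition into blocks\<close>

lemma trace_simps: "trace (X + Y) = trace X + trace Y" "trace (X - Y) = trace X - trace Y"
  "trace (r *\<^sub>R X) = r * trace X" "trace (0 :: real^'n^'n) = 0" for X Y :: "real^'n^'n"
  by (simp_all add: trace_def sum.distrib sum_subtractf sum_distrib_left)

lemma trace_mat_1: "trace (mat 1 :: real^'n^'n) = real CARD('n)"
  by (simp add: trace_def mat_def)

lemma mat_bracket_sl: "mat_bracket X Y \<in> sl"
  using trace_mul_sym[of X Y] by (simp add: sl_def mat_bracket_def trace_simps)

lemma mat_bracket_swap_sign: "mat_bracket X Y = - mat_bracket Y X"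
  by (simp add: mat_bracket_def)

lemma mat_bracket_add_scalar:
  "mat_bracket (c *\<^sub>R mat 1 + X) Y = mat_bracket X Y"
  "mat_bracket X (c *\<^sub>R mat 1 + Y) = mat_bracket X Y"
  by (simp_all add: mat_bracket_simps) (simp_all add: mat_bracket_def)

lemma add_scalarsI: "X \<in> h \<Longrightarrow> c *\<^sub>R mat 1 + X \<in> add_scalars h"
  by (auto simp: add_scalars_def)

lemma add_scalarsE:
  assumes "X \<in> add_scalars h"
  obtains c Y where "X = c *\<^sub>R mat 1 + Y" "Y \<in> h"
  using assms by (auto simp: add_scalars_def)

lemma subset_add_scalars: "X \<in> h \<Longrightarrow> X \<in> add_scalars h"
  using add_scalarsI[of X h 0] by simp

lemma one_in_add_scalars: "subspace h \<Longrightarrow> mat 1 \<in> add_scalars h"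
  using add_scalarsI[of 0 h 1] by (simp add: subspace_0)

lemma subspace_add_scalars:
  assumes h: "subspace h"
  shows "subspace (add_scalars h)"
proof (rule subspaceI)
  show "0 \<in> add_scalars h" using subset_add_scalars subspace_0[OF h] by blast
next
  fix X Y assume "X \<in> add_scalars h" "Y \<in> add_scalars h"
  then obtain c X' d Y' where "X = c *\<^sub>R mat 1 + X'" "X' \<in> h" "Y = d *\<^sub>R mat 1 + Y'" "Y' \<in> h"
    by (metis add_scalarsE)
  moreover from this have "X + Y = (c + d) *\<^sub>R mat 1 + (X' + Y')" by (simp add: algebra_simps)
  ultimately show "X + Y \<in> add_scalars h" by (metis add_scalarsI subspace_add[OF h])
next
  fix r X assume "X \<in> add_scalars h"
  then obtain c X' where "X = c *\<^sub>R mat 1 + X'" "X' \<in> h" by (metis add_scalarsE)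
  moreover from this have "r *\<^sub>R X = (r * c) *\<^sub>R mat 1 + r *\<^sub>R X'" by (simp add: algebra_simps)
  ultimately show "r *\<^sub>R X \<in> add_scalars h" by (metis add_scalarsI subspace_scale[OF h])
qed

text \<open>The trace detects the scalar component, so \<open>h\<close> can be recovered from
  \<open>add_scalars h\<close>.\<close>

lemma add_scalars_sl:
  assumes "h \<subseteq> sl"
  shows "X \<in> h \<longleftrightarrow> X \<in> add_scalars h \<and> X \<in> sl"
proof
  assume "X \<in> h"
  then show "X \<in> add_scalars h \<and> X \<in> sl" using assms subset_add_scalars by blast
next
  assume X: "X \<in> add_scalars h \<and> X \<in> sl"
  then obtain c Y where Y: "X = c *\<^sub>R mat 1 + Y" "Y \<in> h" by (metis add_scalarsE)
  then have "trace X = 0" "trace Y = 0" using X assms by (auto simp: sl_def)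
  then have "c = 0" using Y(1) by (simp add: trace_simps trace_mat_1)
  then show "X \<in> h" using Y by simp
qed

lemma add_scalars_abelian:
  assumes "lie_abelian h mat_bracket" "X \<in> add_scalars h" "Y \<in> add_scalars h"
  shows "mat_bracket X Y = 0"
  using assms(2,3)
  by (elim add_scalarsE) (use assms(1) in \<open>simp add: mat_bracket_add_scalar lie_abelian_def\<close>)

lemma lie_abelian_nilpotent:
  assumes "lie_abelian h br"
  shows "lie_nilpotent h br"
proof -
  have "{br x y |x y. x \<in> h \<and> y \<in> lower_central_series h br 0} \<subseteq> {0}"
    using assms by (auto simp: lie_abelian_def)
  then have "span {br x y |x y. x \<in> h \<and> y \<in> lower_central_series h br 0} \<subseteq> span {0}"
    by (rule span_mono)
  then have "lower_central_series h br (Suc 0) = {0}"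
    using span_zero by (auto simp: span_insert_0)
  then show ?thesis unfolding lie_nilpotent_def by blast
qed

lemma cartan_imp_poly_algebra:
  fixes h :: "(real^'n^'n) set"
  assumes car: "cartan_subalgebra h sl mat_bracket" and ab: "lie_abelian h mat_bracket"
  shows "\<exists>M. nonderogatory M \<and> card (complex_eigenvalues UNIV ((*v) M)) = CARD('n) \<and>
    add_scalars h = poly_algebra M"
proof -
  let ?B = "add_scalars h"
  have h: "subspace h" "h \<subseteq> sl" and nrm: "lie_normalizer h sl mat_bracket = h"
    using car by (auto simp: cartan_subalgebra_def lie_subalgebra_def)
  \<comment> \<open>Self-normalization passes from \<open>h\<close> inside \<open>sl\<close> to
    \<open>?B\<close> inside all matrices: scalars do not change brackets, so \<open>X\<close> may
    be replaced by its traceless part, and all brackets are traceless.\<close>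
  have norm: "X \<in> ?B" if X: "\<And>b. b \<in> ?B \<Longrightarrow> mat_bracket b X \<in> ?B" for X
  proof -
    define c where "c = trace X / real CARD('n)"
    define X0 where "X0 = (- c) *\<^sub>R mat 1 + X"
    have X_eq: "X = c *\<^sub>R mat 1 + X0" by (simp add: X0_def)
    have "trace X0 = 0"
      unfolding X0_def trace_simps trace_mat_1 by (simp add: c_def)
    then have "X0 \<in> sl" by (simp add: sl_def)
    moreover have "mat_bracket X0 y \<in> h" if y: "y \<in> h" for y
    proof -
      have "mat_bracket y X \<in> h"
        using X[OF subset_add_scalars[OF y]] add_scalars_sl[OF h(2)] mat_bracket_sl by blast
      then have "- mat_bracket y X \<in> h" by (rule subspace_neg[OF h(1)])
      then show ?thesis unfolding X0_def mat_bracket_add_scalar using mat_bracket_swap_sign by metis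
    qed
    ultimately have "X0 \<in> lie_normalizer h sl mat_bracket" by (simp add: lie_normalizer_def)
    then show ?thesis using nrm add_scalarsI X_eq by metis
  qed
  obtain M where M: "M \<in> ?B" "card (complex_eigenvalues UNIV ((*v) M)) = CARD('n)"
    using self_normalizing_regular_element[OF subspace_add_scalars[OF h(1)] add_scalars_abelian[OF ab]]
      norm by blast
  obtain lam v sg Q where "eigenbasis M lam v sg Q" using eigenbasis_exists[OF M(2)] by blast
  then interpret eigenbasis M lam v sg Q .
  have sub: "X \<in> poly_algebra M" if "X \<in> ?B" for X
    using add_scalars_abelian[OF ab that M(1)]
    by (simp add: mat_bracket_def flip: centralizer_eq_poly_algebra)
  \<comment> \<open>\<real>[M] is commutative and contains \<open>?B\<close>, so each of its
    elements normalizes \<open>?B\<close>.\<close>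
  moreover have "X \<in> ?B" if X: "X \<in> poly_algebra M" for X
  proof (rule norm)
    fix b assume "b \<in> ?B"
    then have "mat_bracket b X = 0"
      using commute_poly_algebra[OF sub X] by (simp add: mat_bracket_def)
    then show "mat_bracket b X \<in> ?B"
      using subspace_0[OF subspace_add_scalars[OF h(1)]] by simp
  qed
  ultimately have "?B = poly_algebra M" by blast
  then show ?thesis using nonderogatory M(2) by blast
qed

text \<open>\<open>f l\<close> vanishes on the span of the other vectors but not on
  \<open>s l\<close>; duality thus gives both injectivity and independence.\<close>

lemma dim_dual_family:
  fixes s :: "'k \<Rightarrow> 'a::real_vector" and f :: "'k \<Rightarrow> 'a \<Rightarrow> real"
  assumes "\<And>k. k \<in> K \<Longrightarrow> linear (f k)"
    and dual: "\<And>k l. k \<in> K \<Longrightarrow> l \<in> K \<Longrightarrow> f k (s l) = (if k = l then 1 else 0)"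
  shows "dim (span (s ` K)) = card K"
proof -
  have inj: "inj_on s K"
    by (rule inj_onI) (metis dual zero_neq_one)
  have "independent (s ` K)"
    unfolding dependent_def
  proof clarify
    fix l assume l: "l \<in> K" "s l \<in> span (s ` K - {s l})"
    have "subspace {x. f l x = 0}"
      using assms(1)[OF l(1)] by (rule linear_subspace_kernel)
    moreover have "s ` K - {s l} \<subseteq> {x. f l x = 0}" using dual l(1) by auto
    ultimately have "span (s ` K - {s l}) \<subseteq> {x. f l x = 0}" by (rule span_minimal[rotated])
    then show False using l dual[of l l] by auto
  qed
  then show ?thesis using inj by (subst dim_span_eq_card_independent) (simp_all add: card_image)
qed

lemma mat_mult_vec: "mat z *v w = z *s w" for z :: complex
  by (simp add: vec_eq_iff mat_def matrix_vector_mult_def if_distrib if_distribR cong: if_cong)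

text \<open>The two real matrices of \<open>complex_eigenvalues\<close> are packed into one complex
  matrix. \<open>mat z ** W\<close> is the scalar multiple of \<open>W\<close> by
  \<open>z\<close>.\<close>

lemma complex_eigenvalues_ad:
  fixes X :: "real^'n^'n"
  shows "z \<in> complex_eigenvalues sl (mat_bracket X) \<longleftrightarrow>
    (\<exists>W. W \<noteq> 0 \<and> trace W = 0 \<and> cad (cmat X) W = mat z ** W)"
proof -
  have entry: "(mat z ** W) $ i $ j = z * W $ i $ j" for W :: "complex^'n^'n" and i j
    by (simp add: mat_def matrix_matrix_mult_def if_distrib if_distribR cong: if_cong)
  have iff: "cad (cmat X) W = mat z ** W \<longleftrightarrow>
      mat_bracket X (Re_mat W) = Re z *\<^sub>R Re_mat W - Im z *\<^sub>R Im_mat W \<and>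
      mat_bracket X (Im_mat W) = Im z *\<^sub>R Re_mat W + Re z *\<^sub>R Im_mat W" for W
    unfolding cad_cmat[symmetric] by (auto simp: vec_eq_iff complex_eq_iff entry)
  have tr: "trace W = 0 \<longleftrightarrow> Re_mat W \<in> sl \<and> Im_mat W \<in> sl" for W :: "complex^'n^'n"
    by (simp add: sl_def trace_def complex_eq_iff)
  have nz: "W = 0 \<longleftrightarrow> Re_mat W = 0 \<and> Im_mat W = 0" for W :: "complex^'n^'n"
    by (auto simp: vec_eq_iff complex_eq_iff)
  show ?thesis
  proof
    assume "z \<in> complex_eigenvalues sl (mat_bracket X)"
    then obtain u v where uv: "u \<in> sl" "v \<in> sl" "u \<noteq> 0 \<or> v \<noteq> 0"
      "mat_bracket X u = Re z *\<^sub>R u - Im z *\<^sub>R v" "mat_bracket X v = Im z *\<^sub>R u + Re z *\<^sub>R v"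
      by (auto simp: complex_eigenvalues_def)
    define W :: "complex^'n^'n" where "W = (\<chi> i j. Complex (u $ i $ j) (v $ i $ j))"
    have "Re_mat W = u" "Im_mat W = v" by (simp_all add: W_def vec_eq_iff)
    then show "\<exists>W. W \<noteq> 0 \<and> trace W = 0 \<and> cad (cmat X) W = mat z ** W"
      using uv iff[of W] tr[of W] nz[of W] by metis
  next
    assume "\<exists>W. W \<noteq> 0 \<and> trace W = 0 \<and> cad (cmat X) W = mat z ** W"
    then show "z \<in> complex_eigenvalues sl (mat_bracket X)"
      unfolding iff tr nz complex_eigenvalues_def by blast
  qed
qed

section \<open>Adjoint spectrum, toroidal part and vector part\<close>

context eigenbasis
begin

lemma poly_algebra_sl:
  assumes "h \<subseteq> sl" "add_scalars h = poly_algebra M"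
  shows "X \<in> h \<longleftrightarrow> X \<in> poly_algebra M \<and> trace X = 0"
  using add_scalars_sl[OF assms(1), of X] assms(2) by (simp add: sl_def)

text \<open>If \<open>[X, M]\<close> commutes with \<open>M\<close>, it vanishes: in an eigenbasis of \<open>M\<close> it is diagonal, and
  its diagonal entries are zero.\<close>

lemma poly_algebra_imp_cartan:
  assumes h: "lie_subalgebra h sl mat_bracket" and ab: "lie_abelian h mat_bracket"
    and eq: "add_scalars h = poly_algebra M"
  shows "cartan_subalgebra h sl mat_bracket"
proof -
  have sub: "h \<subseteq> sl" and spc: "subspace h" using h by (auto simp: lie_subalgebra_def)
  have "X \<in> h" if X: "X \<in> sl" "\<And>y. y \<in> h \<Longrightarrow> mat_bracket X y \<in> h" for X
  proof -
    \<comment> \<open>\<open>M\<close> need not be traceless, but it differs by a scalar from an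
      element of \<open>h\<close>, so the assumption on \<open>X\<close> controls the bracket with
      \<open>M\<close>.\<close>
    have "M \<in> poly_algebra M" by (simp flip: centralizer_eq_poly_algebra)
    then obtain c Y where Y: "M = c *\<^sub>R mat 1 + Y" "Y \<in> h" using eq by (metis add_scalarsE)
    define D where "D = mat_bracket X M"
    have "D = mat_bracket X Y" unfolding D_def by (simp add: Y(1) mat_bracket_add_scalar)
    then have D: "D \<in> poly_algebra M" using X(2)[OF Y(2)] poly_algebra_sl[OF sub eq] by simp
    have "dg D i = 0" for i
      by (simp add: dg_def D_def mat_bracket_def cmat_diff cmat_mult matrix_vector_mult_diff_rdistrib
          co_simps eig vec.scale co_M flip: matrix_vector_mul_assoc)
    then have "D = 0" using poly_algebra_v[OF D] by (intro real_matrix_eq_on_basis) simp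
    then have "X ** M = M ** X" by (simp add: D_def mat_bracket_def)
    then show "X \<in> h" using X(1) poly_algebra_sl[OF sub eq] by (simp add: centralizer_eq_poly_algebra sl_def)
  qed
  then have "lie_normalizer h sl mat_bracket \<subseteq> h" by (auto simp: lie_normalizer_def)
  moreover have "h \<subseteq> lie_normalizer h sl mat_bracket"
    using h by (auto simp: lie_normalizer_def lie_subalgebra_def)
  ultimately show ?thesis
    using h lie_abelian_nilpotent[OF ab] by (auto simp: cartan_subalgebra_def)
qed

lemma co_poly_algebra:
  assumes "X \<in> poly_algebra M"
  shows "co i (cmat X *v w) = dg X i * co i w"
proof -
  have "cmat X *v w = (\<Sum>i\<in>UNIV. (dg X i * co i w) *s v i)"
    by (subst co_expand[of w, symmetric])
      (simp add: vec.sum vec.scale poly_algebra_v[OF assms] mult.commute)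
  then show ?thesis by (simp add: co_sum_v)
qed

text \<open>In the eigenbasis the adjoint operator of \<open>X\<close> multiplies the (i, j) entry
  of \<open>W\<close> by \<open>dg X i - dg X j\<close>; any nonzero entry identifies
  \<open>z\<close>.\<close>

lemma ad_eigenvalue_difference:
  assumes X: "X \<in> poly_algebra M" and z: "z \<in> complex_eigenvalues sl (mat_bracket X)"
  shows "\<exists>i j. z = dg X i - dg X j"
proof -
  obtain W where W: "W \<noteq> 0" "cad (cmat X) W = mat z ** W"
    using z by (auto simp: complex_eigenvalues_ad)
  then obtain j where "W *v v j \<noteq> 0 *v v j" using matrix_eq_on_basis by blast
  then obtain i where i: "co i (W *v v j) \<noteq> 0"
    using co_eqI[of "W *v v j" 0] by (auto simp: co_simps)
  have "co i (cad (cmat X) W *v v j) = (dg X i - dg X j) * co i (W *v v j)"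
    by (simp add: cad_def matrix_vector_mult_diff_rdistrib co_simps co_poly_algebra[OF X]
        poly_algebra_v[OF X] vec.scale algebra_simps flip: matrix_vector_mul_assoc)
  moreover have "co i (cad (cmat X) W *v v j) = z * co i (W *v v j)"
    by (simp add: W(2) mat_mult_vec co_simps flip: matrix_vector_mul_assoc)
  ultimately have "z = dg X i - dg X j" using i by simp
  then show ?thesis by blast
qed

text \<open>The eigenvector is a matrix unit of the eigenbasis, \<open>v i\<close> times the dual
  covector \<open>Q $ j\<close>. It is off-diagonal, hence traceless.\<close>

lemma difference_ad_eigenvalue:
  assumes X: "X \<in> poly_algebra M" and ij: "i \<noteq> j"
  shows "dg X i - dg X j \<in> complex_eigenvalues sl (mat_bracket X)"
proof -
  define W where "W = outer (v i) (Q $ j)"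
  have Wv: "W *v w = co j w *s v i" for w
    by (simp add: W_def vec_eq_iff matrix_vector_mult_def co_def sum_distrib_left mult_ac)
  have "W *v v j \<noteq> 0" by (simp add: Wv v_nonzero)
  then have "W \<noteq> 0" by auto
  moreover have "trace W = co j (v i)"
    by (simp add: trace_def W_def co_def matrix_vector_mult_def mult.commute)
  then have "trace W = 0" using ij by simp
  moreover have "cad (cmat X) W = mat (dg X i - dg X j) ** W"
    by (rule matrix_eq_on_basis)
      (auto simp: cad_def matrix_vector_mult_diff_rdistrib Wv vec.scale poly_algebra_v[OF X] co_simps
        mat_mult_vec vec.scale_left_diff_distrib simp flip: matrix_vector_mul_assoc)
  ultimately show ?thesis unfolding complex_eigenvalues_ad by blast
qed

text \<open>Purely imaginary differences make all the real parts equal, and the vanishing trace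
  makes their common value 0.\<close>

lemma toroidal_part_eq:
  assumes h: "h \<subseteq> sl" "add_scalars h = poly_algebra M"
  shows "toroidal_part h sl mat_bracket = {X \<in> h. \<forall>i. Re (dg X i) = 0}"
proof (intro equalityI subsetI)
  fix X assume X: "X \<in> toroidal_part h sl mat_bracket"
  then have Xh: "X \<in> h" by (simp add: toroidal_part_def)
  then have XM: "X \<in> poly_algebra M" "trace X = 0" using poly_algebra_sl[OF h] by auto
  have eq: "Re (dg X j) = Re (dg X i)" for i j
    using X difference_ad_eigenvalue[OF XM(1), of i j] by (cases "i = j") (auto simp: toroidal_part_def)
  have "Re (dg X i) = 0" for i
  proof -
    have "0 = Re (\<Sum>j\<in>UNIV. dg X j)" using trace_dg[of X] XM(2) by simp
    also have "\<dots> = (\<Sum>j\<in>(UNIV :: 'n set). Re (dg X i))" unfolding Re_sum by (intro sum.cong refl eq)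
    finally show ?thesis by simp
  qed
  then show "X \<in> {X \<in> h. \<forall>i. Re (dg X i) = 0}" using Xh by simp
next
  fix X assume X: "X \<in> {X \<in> h. \<forall>i. Re (dg X i) = 0}"
  then have "X \<in> poly_algebra M" using poly_algebra_sl[OF h] by auto
  then show "X \<in> toroidal_part h sl mat_bracket"
    using X ad_eigenvalue_difference by (fastforce simp: toroidal_part_def)
qed

text \<open>Conjugate pairs suffice here: the difference of the entries at \<open>sg i\<close> and
  \<open>i\<close> is -2 \<i> times the imaginary part at \<open>i\<close>.\<close>

lemma vector_part_eq:
  assumes h: "h \<subseteq> sl" "add_scalars h = poly_algebra M"
  shows "vector_part h sl mat_bracket = {X \<in> h. \<forall>i. Im (dg X i) = 0}"
proof (intro equalityI subsetI)
  fix X assume X: "X \<in> vector_part h sl mat_bracket"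
  then have Xh: "X \<in> h" by (simp add: vector_part_def)
  then have XM: "X \<in> poly_algebra M" using poly_algebra_sl[OF h] by auto
  have "Im (dg X i) = 0" for i
  proof -
    have "Im (dg X (sg i)) = Im (dg X i)"
      using X difference_ad_eigenvalue[OF XM, of "sg i" i]
      by (cases "sg i = i") (auto simp: vector_part_def)
    then show ?thesis using sym_dg[of X] by (simp add: sym_def)
  qed
  then show "X \<in> {X \<in> h. \<forall>i. Im (dg X i) = 0}" using Xh by simp
next
  fix X assume X: "X \<in> {X \<in> h. \<forall>i. Im (dg X i) = 0}"
  then have "X \<in> poly_algebra M" using poly_algebra_sl[OF h] by auto
  then show "X \<in> vector_part h sl mat_bracket"
    using X ad_eigenvalue_difference by (fastforce simp: vector_part_def)
qed

definition real_mat :: "('n \<Rightarrow> complex) \<Rightarrow> real^'n^'n" where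
  "real_mat z = (SOME X. X \<in> poly_algebra M \<and> (\<forall>i. cmat X *v v i = z i *s v i))"

text \<open>For symmetric \<open>y\<close> the sum is fixed by conjugation, so passing to its real
  part loses nothing (\<open>co_real_vec\<close>).\<close>

definition real_vec :: "('n \<Rightarrow> complex) \<Rightarrow> real^'n" where
  "real_vec y = Re_vec (\<Sum>i\<in>UNIV. y i *s v i)"

lemma real_mat:
  assumes "sym z"
  shows "real_mat z \<in> poly_algebra M" "dg (real_mat z) = z"
proof -
  have "real_mat z \<in> poly_algebra M \<and> (\<forall>i. cmat (real_mat z) *v v i = z i *s v i)"
    unfolding real_mat_def by (rule someI_ex) (use poly_algebra_interpolation[OF assms] in blast)
  then show "real_mat z \<in> poly_algebra M" "dg (real_mat z) = z" by (auto intro: dg_eqI)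
qed

lemma co_real_vec:
  assumes "sym y"
  shows "co i (cvec (real_vec y)) = y i"
proof -
  have "cnj_vec (\<Sum>i\<in>UNIV. y i *s v i) = (\<Sum>i\<in>UNIV. y (sg i) *s v (sg i))"
    using assms by (simp add: cnj_vec_sum cnj_vec_smult v_sg sym_def)
  also have "\<dots> = (\<Sum>i\<in>UNIV. y i *s v i)"
    using sum.reindex_bij_betw[OF bij_sg, of "\<lambda>i. y i *s v i"] by simp
  finally have "cvec (real_vec y) = (\<Sum>i\<in>UNIV. y i *s v i)" unfolding real_vec_def by (rule cvec_Re_vec)
  then show ?thesis by (simp add: co_sum_v)
qed

section \<open>Coordinates on the semidirect product and its blocks\<close>

lemma sym_co: "sym (\<lambda>i. co i (cvec x))"
  unfolding sym_def by (metis co_cnj cnj_vec_cvec)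

lemma cvec_eqI: "(\<And>i. co i (cvec x) = co i (cvec y)) \<Longrightarrow> x = y"
  using co_eqI cvec_inject by blast

text \<open>On \<open>L\<close> each index gives a Lie homomorphism to aff(\<complex>)
  (\<open>coords_bracket\<close>). Jointly they are injective, and their image is cut out by
  conjugation symmetry (\<open>coords_eqI\<close>, \<open>exists_coords\<close>).\<close>

definition coords :: "'n \<Rightarrow> (real^'n^'n) \<times> (real^'n) \<Rightarrow> complex \<times> complex" where
  "coords i u = (dg (fst u) i, co i (cvec (snd u)))"

abbreviation "L \<equiv> semidirect (poly_algebra M)"

lemma subspace_poly_algebra: "subspace (poly_algebra M)"
  by (rule subspaceI)
    (simp_all add: matrix_add_ldistrib matrix_add_rdistrib matrix_scalar_ac
      flip: centralizer_eq_poly_algebra scalar_matrix_assoc)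

lemma subspace_L: "subspace L"
  unfolding semidirect_def by (intro subspace_Times subspace_poly_algebra subspace_UNIV)

lemma linear_dg: "linear (\<lambda>X. dg X i)"
  by (intro linearI) (simp_all add: dg_def cmat_add cmat_scaleR scaleR_matrix_vector_mult
      matrix_vector_mult_add_rdistrib co_simps scaleR_conv_of_real[where 'a = complex])

lemma linear_coords: "linear (coords i)"
proof (rule linearI)
  show "coords i (u + w) = coords i u + coords i w" for u w
    using linear_add[OF linear_dg] by (simp add: coords_def cvec_add co_simps)
  show "coords i (r *\<^sub>R u) = r *\<^sub>R coords i u" for r u
    using linear_scale[OF linear_dg]
    by (simp add: coords_def cvec_scaleR co_simps scaleR_conv_of_real[where 'a = complex])
qed

lemma coords_eqI:
  assumes "u \<in> L" "w \<in> L" "\<And>i. coords i u = coords i w"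
  shows "u = w"
proof (rule prod_eqI)
  show "fst u = fst w"
    using assms by (intro poly_algebra_eqI) (auto simp: semidirect_def coords_def)
  show "snd u = snd w"
    using assms(3) by (intro cvec_eqI) (simp add: coords_def)
qed

lemma coords_sg: "coords (sg i) u = map_prod cnj cnj (coords i u)"
  using sym_dg[of "fst u"] sym_co[of "snd u"] by (simp add: coords_def sym_def)

lemma coords_bracket:
  assumes "u \<in> L" "w \<in> L"
  shows "coords i (semidirect_bracket u w) = aff_bracket (coords i u) (coords i w)"
proof -
  have "dg 0 i = 0" by (simp add: dg_def co_simps)
  then show ?thesis
    using assms by (auto simp: coords_def semidirect_bracket_def aff_bracket_def co_simps
        co_poly_algebra semidirect_def cvec_diff simp flip: cmat_mult_cvec)
qed

lemma bracket_L: "semidirect_bracket u w \<in> L"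
  using subspace_0[OF subspace_poly_algebra] by (simp add: semidirect_bracket_def semidirect_def)

lemma exists_coords:
  assumes "\<And>i. z (sg i) = map_prod cnj cnj (z i)"
  shows "\<exists>u\<in>L. \<forall>i. coords i u = z i"
proof -
  have z: "sym (\<lambda>i. fst (z i))" "sym (\<lambda>i. snd (z i))" using assms by (simp_all add: sym_def)
  have "(real_mat (\<lambda>i. fst (z i)), real_vec (\<lambda>i. snd (z i))) \<in> L" by (simp add: semidirect_def real_mat z)
  moreover have "coords i (real_mat (\<lambda>i. fst (z i)), real_vec (\<lambda>i. snd (z i))) = z i" for i
    by (simp add: coords_def real_mat[OF z(1)] co_real_vec[OF z(2)])
  ultimately show ?thesis by blast
qed

text \<open>The data at \<open>k\<close> and \<open>sg k\<close> are conjugate, so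
  \<open>coords k\<close> alone determines an element: a pair of complex numbers if
  \<open>sg k\<close> differs from \<open>k\<close>, a pair of real ones otherwise.\<close>

definition block :: "'n \<Rightarrow> ((real^'n^'n) \<times> (real^'n)) set" where
  "block k = {u \<in> L. \<forall>i. i \<noteq> k \<and> i \<noteq> sg k \<longrightarrow> coords i u = 0}"

lemma block_ideal: "lie_ideal (block k) L semidirect_bracket"
  unfolding lie_ideal_def
proof (intro conjI ballI)
  show "subspace (block k)"
    using subspace_L by (auto simp: block_def subspace_def linear_0[OF linear_coords]
        linear_add[OF linear_coords] linear_scale[OF linear_coords])
  show "block k \<subseteq> L" by (auto simp: block_def)
  show "semidirect_bracket u w \<in> block k" if "u \<in> L" "w \<in> block k" for u w
    using that bracket_L by (auto simp: block_def coords_bracket aff_bracket_def zero_prod_def)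
qed

lemma block_coords_eqI:
  assumes "u \<in> block k" "w \<in> block k" "coords k u = coords k w"
  shows "u = w"
proof (rule coords_eqI)
  fix i
  show "coords i u = coords i w"
    using assms coords_sg[of k u] coords_sg[of k w] by (cases "i = k \<or> i = sg k") (auto simp: block_def)
qed (use assms in \<open>auto simp: block_def\<close>)

lemma exists_block:
  assumes "sg k = k \<Longrightarrow> map_prod cnj cnj c = c"
  shows "\<exists>u\<in>block k. coords k u = c"
proof -
  define z where "z i = (if i = k then c else if i = sg k then map_prod cnj cnj c else 0)" for i
  have "z (sg i) = map_prod cnj cnj (z i)" for i
  proof -
    have "map_prod cnj cnj (map_prod cnj cnj c) = c" by (cases c) simp
    moreover have "map_prod cnj cnj (0 :: complex \<times> complex) = 0" by (simp add: zero_prod_def)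
    ultimately show ?thesis
      using assms by (auto simp: z_def)
  qed
  from exists_coords[of z, OF this] obtain u where "u \<in> L" "\<And>i. coords i u = z i" by blast
  then have "u \<in> block k" "coords k u = c" by (auto simp: block_def z_def)
  then show ?thesis by blast
qed

text \<open>One argument for both kinds of block: \<iota> is the identity of \<complex> for a
  conjugate pair and the inclusion of \<real> for a fixed index. The isomorphism inverts
  \<open>coords k\<close>.\<close>

lemma block_lie_isomorphic:
  fixes \<iota> :: "'k::real_normed_field \<Rightarrow> complex"
  assumes lin: "linear \<iota>" and "inj \<iota>" and mult: "\<And>a b. \<iota> (a * b) = \<iota> a * \<iota> b"
    and real: "sg k = k \<Longrightarrow> range \<iota> = \<real>" and complex: "sg k \<noteq> k \<Longrightarrow> range \<iota> = UNIV"
  shows "lie_isomorphic UNIV (aff_bracket :: 'k \<times> 'k \<Rightarrow> _) (block k) semidirect_bracket"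
proof -
  let ?i = "map_prod \<iota> \<iota>"
  have "\<exists>u\<in>block k. coords k u = ?i c" for c
  proof (rule exists_block)
    assume "sg k = k"
    then have "\<iota> a \<in> \<real>" for a using real by blast
    then show "map_prod cnj cnj (?i c) = ?i c"
      by (cases c) (simp add: Reals_cnj_iff)
  qed
  then obtain f where f: "\<And>c. f c \<in> block k" "\<And>c. coords k (f c) = ?i c" by metis
  have spc: "subspace (block k)" using block_ideal by (simp add: lie_ideal_def)
  have "linear f"
  proof (rule linearI)
    show "f (c + d) = f c + f d" for c d
      by (rule block_coords_eqI[of _ k])
        (simp_all add: f subspace_add spc linear_add[OF linear_coords] linear_add[OF lin] prod_eq_iff)
    show "f (r *\<^sub>R c) = r *\<^sub>R f c" for r c
      by (rule block_coords_eqI[of _ k])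
        (simp_all add: f subspace_scale spc linear_scale[OF linear_coords] linear_scale[OF lin] prod_eq_iff)
  qed
  moreover have "bij_betw f UNIV (block k)"
  proof (rule bij_betw_imageI)
    show "inj f"
    proof (rule injI)
      fix c d assume "f c = f d"
      then have "?i c = ?i d" by (simp flip: f(2))
      then show "c = d" using \<open>inj \<iota>\<close> by (auto simp: prod_eq_iff inj_eq)
    qed
    have "u \<in> range f" if u: "u \<in> block k" for u
    proof -
      have "coords k u \<in> range \<iota> \<times> range \<iota>"
      proof (cases "sg k = k")
        case True
        then have "map_prod cnj cnj (coords k u) = coords k u" using coords_sg[of k u] by simp
        then show ?thesis using real[OF True] by (cases "coords k u") (simp add: Reals_cnj_iff)
      qed (use complex in auto)
      then obtain c where "coords k u = ?i c" by (cases "coords k u") auto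
      then have "u = f c" by (intro block_coords_eqI[of _ k] u f) (simp add: f)
      then show ?thesis by simp
    qed
    then show "range f = block k" using f(1) by blast
  qed
  moreover have "f (aff_bracket c d) = semidirect_bracket (f c) (f d)" for c d
  proof (rule block_coords_eqI[of _ k])
    have L: "f c \<in> L" for c using f(1) by (auto simp: block_def)
    show "semidirect_bracket (f c) (f d) \<in> block k"
      using block_ideal f(1) L by (auto simp: lie_ideal_def)
    show "coords k (f (aff_bracket c d)) = coords k (semidirect_bracket (f c) (f d))"
      by (simp add: coords_bracket[OF L L] f aff_bracket_def mult linear_diff[OF lin] linear_0[OF lin])
  qed (rule f)
  ultimately show ?thesis unfolding lie_isomorphic_def by blast
qed

section \<open>Direct sum of the blocks\<close>

lemma Im_lam_sg: "Im (lam (sg i)) = - Im (lam i)"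
  by (simp add: lam_sg)

lemma sg_fixed_iff: "sg i = i \<longleftrightarrow> Im (lam i) = 0"
proof
  assume "Im (lam i) = 0"
  then have "lam (sg i) = lam i" by (simp add: lam_sg complex_eq_iff)
  then show "sg i = i" using inj_lam by (simp add: inj_eq)
qed (use Im_lam_sg[of i] in simp)

lemma is_sum_of_affs_poly_algebra:
  "is_sum_of_affs L semidirect_bracket (card {i. Im (lam i) > 0}) (card {i. Im (lam i) = 0})"
proof -
  let ?P = "{i. Im (lam i) > 0}" and ?R = "{i. Im (lam i) = 0}"
  let ?p = "card ?P" and ?q = "card ?R"
  obtain g1 where g1: "bij_betw g1 {..<?p} ?P" using ex_bij_betw_nat_finite[of ?P] by (auto simp: atLeast0LessThan)
  obtain g2 where g2: "bij_betw g2 {..<?q} ?R" using ex_bij_betw_nat_finite[of ?R] by (auto simp: atLeast0LessThan)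
  \<comment> \<open>One representative of each orbit of \<open>sg\<close>: first the upper
    half-plane, giving complex blocks, then the real eigenvalues. The lower half-plane is reached
    through \<open>sg\<close>.\<close>
  define e where "e m = (if m < ?p then g1 m else g2 (m - ?p))" for m
  have e1: "e m \<in> ?P" if "m < ?p" for m using that g1 by (auto simp: e_def bij_betw_def)
  have e2: "e m \<in> ?R" if "m \<in> {?p..<?p + ?q}" for m
    using that g2 bij_betwE[OF g2] by (auto simp: e_def)
  have e_eq: "l = m" if lm: "l < ?p + ?q" "m < ?p + ?q" and "e l = e m \<or> e l = sg (e m)" for l m
  proof -
    have nonneg: "Im (lam (e m)) \<ge> 0" if "m < ?p + ?q" for m
      using that e1[of m] e2[of m] by (cases "m < ?p") auto
    have "e l = e m"
    proof (cases "e l = e m")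
      case False
      then have "e l = sg (e m)" using that by blast
      then have "Im (lam (e m)) = 0" using nonneg[OF lm(1)] nonneg[OF lm(2)] by (simp add: Im_lam_sg)
      then show ?thesis using \<open>e l = sg (e m)\<close> by (metis sg_fixed_iff)
    qed
    moreover have "l < ?p \<longleftrightarrow> m < ?p"
      using calculation e1[of l] e1[of m] e2[of l] e2[of m] lm by force
    moreover have "inj_on g1 {..<?p}" "inj_on g2 {..<?q}" using g1 g2 by (auto simp: bij_betw_def)
    ultimately show ?thesis
    proof (cases "l < ?p")
      case True
      then show ?thesis
        using \<open>e l = e m\<close> \<open>l < ?p \<longleftrightarrow> m < ?p\<close> inj_onD[OF \<open>inj_on g1 {..<?p}\<close>, of l m]
        by (simp add: e_def)
    next
      case False
      then have "g2 (l - ?p) = g2 (m - ?p)"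
        using \<open>e l = e m\<close> \<open>l < ?p \<longleftrightarrow> m < ?p\<close> by (simp add: e_def)
      then have "l - ?p = m - ?p"
        using False lm \<open>l < ?p \<longleftrightarrow> m < ?p\<close> by (intro inj_onD[OF \<open>inj_on g2 {..<?q}\<close>]) auto
      then show ?thesis using False \<open>l < ?p \<longleftrightarrow> m < ?p\<close> by linarith
    qed
  qed
  have e_surj: "\<exists>m<?p + ?q. i = e m \<or> i = sg (e m)" for i
  proof -
    have *: "\<exists>m<?p + ?q. i = e m" if "Im (lam i) \<ge> 0" for i
    proof (cases "Im (lam i) = 0")
      case True
      then have "i \<in> g2 ` {..<?q}" using g2 by (simp add: bij_betw_def)
      then obtain m where "m < ?q" "g2 m = i" by auto
      then show ?thesis by (intro exI[of _ "?p + m"]) (auto simp: e_def)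
    next
      case False
      then have "i \<in> g1 ` {..<?p}" using that g1 by (simp add: bij_betw_def)
      then show ?thesis by (auto simp: e_def)
    qed
    show ?thesis
    proof (cases "Im (lam i) \<ge> 0")
      case False
      then obtain m where "m < ?p + ?q" "sg i = e m" using *[of "sg i"] by (auto simp: Im_lam_sg)
      then show ?thesis by (metis sg_sg)
    qed (use * in blast)
  qed
  define A where "A m = block (e m)" for m
  \<comment> \<open>A coordinate sees only the summand belonging to its own orbit.\<close>
  have sum: "coords i (\<Sum>l<?p + ?q. f l) = coords i (f m)"
    if f: "\<And>l. l < ?p + ?q \<Longrightarrow> f l \<in> A l" and m: "m < ?p + ?q" "i = e m \<or> i = sg (e m)" for f i m
  proof -
    have "coords i (f l) = 0" if "l < ?p + ?q" "l \<noteq> m" for l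
    proof -
      have "e m \<noteq> e l" "e m \<noteq> sg (e l)" using e_eq[OF m(1) that(1)] that(2) by auto
      then have "i \<noteq> e l \<and> i \<noteq> sg (e l)" using m(2) by (metis sg_sg)
      then show ?thesis using f[OF that(1)] by (simp add: A_def block_def)
    qed
    then have "(\<Sum>l<?p + ?q. coords i (f l)) = (\<Sum>l\<in>{m}. coords i (f l))"
      using m(1) by (intro sum.mono_neutral_right) auto
    then show ?thesis by (simp add: linear_sum[OF linear_coords])
  qed
  have sumL: "(\<Sum>l<?p + ?q. f l) \<in> L" if "\<And>l. l < ?p + ?q \<Longrightarrow> f l \<in> A l" for f
    using that by (intro subspace_sum[OF subspace_L]) (auto simp: A_def block_def)
  have "lie_direct_sum L semidirect_bracket {..<?p + ?q} A"
    unfolding lie_direct_sum_def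
  proof (intro conjI ballI)
    show "lie_ideal (A m) L semidirect_bracket" for m unfolding A_def by (rule block_ideal)
    fix x assume x: "x \<in> L"
    have "\<exists>u\<in>A m. coords (e m) u = coords (e m) x" for m
      unfolding A_def by (rule exists_block) (metis coords_sg)
    then obtain g where g: "\<And>m. g m \<in> A m" "\<And>m. coords (e m) (g m) = coords (e m) x" by metis
    show "\<exists>!f. f \<in> (\<Pi>\<^sub>E i\<in>{..<?p + ?q}. A i) \<and> x = (\<Sum>i<?p + ?q. f i)"
    proof (rule ex1I)
      let ?g = "\<lambda>m\<in>{..<?p + ?q}. g m"
      have "x = (\<Sum>i<?p + ?q. g i)"
      proof (rule coords_eqI[OF x sumL])
        fix i
        obtain m where m: "m < ?p + ?q" "i = e m \<or> i = sg (e m)" using e_surj by blast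
        then have "coords i (\<Sum>l<?p + ?q. g l) = coords i (g m)" by (intro sum g)
        also have "\<dots> = coords i x" using m(2) g(2)[of m] coords_sg[of "e m" "g m"] coords_sg[of "e m" x] by auto
        finally show "coords i x = coords i (\<Sum>i<?p + ?q. g i)" by simp
      qed (rule g)
      then show "?g \<in> (\<Pi>\<^sub>E i\<in>{..<?p + ?q}. A i) \<and> x = (\<Sum>i<?p + ?q. ?g i)"
        using g(1) by auto
    next
      fix f assume f: "f \<in> (\<Pi>\<^sub>E i\<in>{..<?p + ?q}. A i) \<and> x = (\<Sum>i<?p + ?q. f i)"
      show "f = (\<lambda>m\<in>{..<?p + ?q}. g m)"
      proof (rule PiE_ext)
        show "f \<in> (\<Pi>\<^sub>E i\<in>{..<?p + ?q}. A i)" using f by blast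
        show "(\<lambda>m\<in>{..<?p + ?q}. g m) \<in> (\<Pi>\<^sub>E i\<in>{..<?p + ?q}. A i)" using g(1) by auto
        fix m assume m: "m \<in> {..<?p + ?q}"
        have fA: "\<And>l. l < ?p + ?q \<Longrightarrow> f l \<in> A l" using f by auto
        have "coords (e m) (f m) = coords (e m) x"
          using sum[OF fA, of m "e m"] m f by simp
        then have "f m = g m"
          using fA[of m] g m by (intro block_coords_eqI[of _ "e m"]) (auto simp: A_def)
        then show "f m = (\<lambda>m\<in>{..<?p + ?q}. g m) m" using m by simp
      qed
    qed
  qed simp
  moreover have "lie_isomorphic UNIV aff_complex_bracket (A m) semidirect_bracket" if "m < ?p" for m
  proof -
    have "sg (e m) \<noteq> e m" using e1[OF that] by (simp add: sg_fixed_iff)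
    then show ?thesis unfolding A_def
      by (intro block_lie_isomorphic[of "\<lambda>z. z"]) (auto simp: linear_iff inj_on_def)
  qed
  moreover have "lie_isomorphic UNIV aff_real_bracket (A m) semidirect_bracket" if "m \<in> {?p..<?p + ?q}" for m
  proof -
    have "sg (e m) = e m" using e2[OF that] by (simp add: sg_fixed_iff)
    then show ?thesis unfolding A_def
      by (intro block_lie_isomorphic[of complex_of_real])
        (auto simp: linear_iff inj_on_def Reals_def scaleR_conv_of_real)
  qed
  ultimately show ?thesis unfolding is_sum_of_affs_def by (intro exI[of _ A]) auto
qed

section \<open>Dimensions of the toroidal and vector parts\<close>

lemma poly_algebra_eqI_upper:
  assumes "X \<in> poly_algebra M" "Y \<in> poly_algebra M" "\<And>i. Im (lam i) \<ge> 0 \<Longrightarrow> dg X i = dg Y i"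
  shows "X = Y"
proof (rule poly_algebra_eqI[OF assms(1,2)])
  fix i
  show "dg X i = dg Y i"
  proof (cases "Im (lam i) \<ge> 0")
    case False
    then have "dg X (sg i) = dg Y (sg i)" by (intro assms(3)) (simp add: Im_lam_sg)
    then show ?thesis using sym_dg[of X] sym_dg[of Y] by (simp add: sym_def)
  qed (rule assms(3))
qed

text \<open>Symmetric families supported on one orbit of \<open>sg\<close>. At a fixed index the
  first test decides, so symmetry there needs a real \<open>a\<close>.\<close>

definition pair_fun :: "'n \<Rightarrow> complex \<Rightarrow> 'n \<Rightarrow> complex" where
  "pair_fun k a i = (if i = k then a else if i = sg k then cnj a else 0)"

lemma sym_pair_fun: "(sg k = k \<Longrightarrow> cnj a = a) \<Longrightarrow> sym (pair_fun k a)"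
  unfolding sym_def pair_fun_def by (metis complex_cnj_cnj complex_cnj_zero sg_sg)

text \<open>Each conjugate pair contributes the matrix with entries \<i> and -\<i>, which is
  automatically traceless. At a real eigenvalue a purely imaginary symmetric entry is 0.\<close>

lemma dim_toroidal_part:
  assumes h: "h \<subseteq> sl" "add_scalars h = poly_algebra M" "subspace h"
  shows "dim (toroidal_part h sl mat_bracket) = card {i. Im (lam i) > 0}"
proof -
  let ?P = "{i. Im (lam i) > 0}" and ?T = "toroidal_part h sl mat_bracket"
  define s where "s k = real_mat (pair_fun k \<i>)" for k
  define f where "f k X = Im (dg X k)" for k and X :: "real^'n^'n"
  have s: "s k \<in> poly_algebra M" "dg (s k) = pair_fun k \<i>" if "k \<in> ?P" for k
    using that sg_fixed_iff[of k] unfolding s_def by (intro real_mat sym_pair_fun; simp)+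
  have T: "?T = {X \<in> h. \<forall>i. Re (dg X i) = 0}" by (rule toroidal_part_eq[OF h(1,2)])
  have subT: "subspace ?T"
    using h(3) unfolding T subspace_def
    by (simp add: linear_0[OF linear_dg] linear_add[OF linear_dg] linear_scale[OF linear_dg])
  have lin: "linear (f k)" for k
    unfolding f_def using linear_compose[OF linear_dg bounded_linear.linear[OF bounded_linear_Im]]
    by (simp add: o_def)
  have sT: "s k \<in> ?T" if k: "k \<in> ?P" for k
  proof -
    have ne: "sg k \<noteq> k" using k sg_fixed_iff[of k] by auto
    have "complex_of_real (trace (s k)) = (\<Sum>i\<in>UNIV. pair_fun k \<i> i)"
      using trace_dg[of "s k"] s[OF k] by simp
    also have "\<dots> = (\<Sum>i\<in>{k, sg k}. pair_fun k \<i> i)"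
      by (intro sum.mono_neutral_right) (auto simp: pair_fun_def)
    also have "\<dots> = 0" using ne by (simp add: pair_fun_def)
    finally have "s k \<in> h" using s[OF k] poly_algebra_sl[OF h(1,2)] by simp
    then show ?thesis unfolding T by (simp add: s[OF k] pair_fun_def)
  qed
  have "?T \<subseteq> span (s ` ?P)"
  proof
    fix X assume X: "X \<in> ?T"
    define Y where "Y = (\<Sum>k\<in>?P. Im (dg X k) *\<^sub>R s k)"
    have YT: "Y \<in> ?T" unfolding Y_def by (intro subspace_sum subT subspace_scale sT)
    have "X = Y"
    proof (rule poly_algebra_eqI_upper)
      show "X \<in> poly_algebra M" "Y \<in> poly_algebra M"
        using X YT poly_algebra_sl[OF h(1,2)] unfolding T by auto
      fix i assume i: "Im (lam i) \<ge> 0"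
      have dgY: "dg Y i = (\<Sum>k\<in>?P. Im (dg X k) *\<^sub>R pair_fun k \<i> i)"
        unfolding Y_def linear_sum[OF linear_dg] linear_scale[OF linear_dg]
        by (intro sum.cong refl) (simp add: s)
      have off: "pair_fun k \<i> i = 0" if "k \<in> ?P" "k \<noteq> i" for k
        using that i Im_lam_sg[of k] by (auto simp: pair_fun_def)
      show "dg X i = dg Y i"
      proof (cases "i \<in> ?P")
        case True
        have "dg Y i = (\<Sum>k\<in>{i}. Im (dg X k) *\<^sub>R pair_fun k \<i> i)"
          unfolding dgY using True off by (intro sum.mono_neutral_right) auto
        then show ?thesis using X unfolding T by (simp add: pair_fun_def complex_eq_iff)
      next
        case False
        then have "dg Y i = 0" unfolding dgY using off by (intro sum.neutral) auto
        moreover have "sg i = i" using False i sg_fixed_iff[of i] by auto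
        then have "Im (dg X i) = 0"
          using sym_dg[of X] unfolding sym_def by (metis Reals_cnj_iff complex_is_Real_iff)
        ultimately show ?thesis using X unfolding T by (simp add: complex_eq_iff)
      qed
    qed
    also have "Y \<in> span (s ` ?P)"
      unfolding Y_def by (intro span_sum span_scale span_base) auto
    finally show "X \<in> span (s ` ?P)" .
  qed
  moreover have "span (s ` ?P) \<subseteq> ?T" using sT subT by (intro span_minimal) auto
  ultimately have "?T = span (s ` ?P)" by blast
  moreover have "dim (span (s ` ?P)) = card ?P"
  proof (rule dim_dual_family[of ?P f])
    fix k l assume kl: "k \<in> ?P" "l \<in> ?P"
    then have "k \<noteq> sg l" using Im_lam_sg[of l] by auto
    then show "f k (s l) = (if k = l then 1 else 0)"
      using s(2)[OF kl(2)] by (simp add: f_def pair_fun_def)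
  qed (rule lin)
  ultimately show ?thesis by simp
qed

text \<open>The matrices with entry 1 on one orbit have nonzero trace, so the count takes place in
  \<open>W\<close>, where the trace is free and the dimension is the number of orbits. Splitting off
  the scalars from \<open>W\<close> leaves the vector part and accounts for the
  \<open>+ 1\<close>.\<close>

lemma dim_vector_part:
  assumes h: "h \<subseteq> sl" "add_scalars h = poly_algebra M" "subspace h"
  shows "dim (vector_part h sl mat_bracket) + 1 = card {i. Im (lam i) > 0} + card {i. Im (lam i) = 0}"
proof -
  let ?T = "{i. Im (lam i) \<ge> 0}" and ?V = "vector_part h sl mat_bracket"
  define s where "s k = real_mat (pair_fun k 1)" for k
  define f where "f k X = Re (dg X k)" for k and X :: "real^'n^'n"
  define W where "W = {X \<in> poly_algebra M. \<forall>i. Im (dg X i) = 0}"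
  have s: "s k \<in> poly_algebra M" "dg (s k) = pair_fun k 1" for k
    unfolding s_def by (intro real_mat sym_pair_fun; simp)+
  have V: "?V = {X \<in> h. \<forall>i. Im (dg X i) = 0}" by (rule vector_part_eq[OF h(1,2)])
  have subV: "subspace ?V"
    using h(3) unfolding V subspace_def
    by (simp add: linear_0[OF linear_dg] linear_add[OF linear_dg] linear_scale[OF linear_dg])
  have subW: "subspace W"
    using subspace_poly_algebra unfolding W_def subspace_def
    by (simp add: linear_0[OF linear_dg] linear_add[OF linear_dg] linear_scale[OF linear_dg])
  have lin: "linear (f k)" for k
    unfolding f_def using linear_compose[OF linear_dg bounded_linear.linear[OF bounded_linear_Re]]
    by (simp add: o_def)
  have sW: "s k \<in> W" for k by (simp add: W_def s pair_fun_def)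
  have "W \<subseteq> span (s ` ?T)"
  proof
    fix X assume X: "X \<in> W"
    define Y where "Y = (\<Sum>k\<in>?T. Re (dg X k) *\<^sub>R s k)"
    have YW: "Y \<in> W" unfolding Y_def by (intro subspace_sum subW subspace_scale sW)
    have "X = Y"
    proof (rule poly_algebra_eqI_upper)
      show "X \<in> poly_algebra M" "Y \<in> poly_algebra M" using X YW unfolding W_def by auto
      fix i assume i: "Im (lam i) \<ge> 0"
      have off: "pair_fun k 1 i = 0" if "k \<in> ?T" "k \<noteq> i" for k
      proof -
        have "i \<noteq> sg k" using that i Im_lam_sg[of k] sg_fixed_iff[of k] by auto
        then show ?thesis using that by (simp add: pair_fun_def)
      qed
      have "dg Y i = (\<Sum>k\<in>?T. Re (dg X k) *\<^sub>R pair_fun k 1 i)"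
        unfolding Y_def linear_sum[OF linear_dg] linear_scale[OF linear_dg] by (simp add: s)
      also have "\<dots> = (\<Sum>k\<in>{i}. Re (dg X k) *\<^sub>R pair_fun k 1 i)"
        using i off by (intro sum.mono_neutral_right) auto
      finally show "dg X i = dg Y i" using X by (simp add: W_def pair_fun_def complex_eq_iff)
    qed
    also have "Y \<in> span (s ` ?T)"
      unfolding Y_def by (intro span_sum span_scale span_base) auto
    finally show "X \<in> span (s ` ?T)" .
  qed
  moreover have "span (s ` ?T) \<subseteq> W" using sW subW by (intro span_minimal) auto
  ultimately have "W = span (s ` ?T)" by blast
  moreover have "dim (span (s ` ?T)) = card ?T"
  proof (rule dim_dual_family[of ?T f])
    fix k l assume kl: "k \<in> ?T" "l \<in> ?T"
    then have "k = sg l \<Longrightarrow> k = l" using Im_lam_sg[of l] sg_fixed_iff[of l] by auto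
    then show "f k (s l) = (if k = l then 1 else 0)" by (auto simp: f_def s pair_fun_def)
  qed (rule lin)
  ultimately have dimW: "dim W = card ?T" by simp
  have dg1: "dg (mat 1) i = 1" for i by (simp add: dg_def)
  have one: "mat 1 \<in> poly_algebra M" using one_in_add_scalars[OF h(3)] h(2) by simp
  have "W = span (insert (mat 1) ?V)"
  proof (intro equalityI subsetI)
    fix X assume X: "X \<in> W"
    then obtain c Y where Y: "X = c *\<^sub>R mat 1 + Y" "Y \<in> h"
      using h(2) unfolding W_def by (metis (no_types, lifting) add_scalarsE mem_Collect_eq)
    have "dg X i = c *\<^sub>R 1 + dg Y i" for i
      unfolding Y(1) linear_add[OF linear_dg] linear_scale[OF linear_dg] dg1 ..
    then have "Y \<in> ?V" using X Y(2) unfolding V W_def by simp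
    then show "X \<in> span (insert (mat 1) ?V)"
      unfolding Y(1) by (intro span_add span_scale span_base) auto
  next
    fix X assume "X \<in> span (insert (mat 1) ?V)"
    moreover have "insert (mat 1) ?V \<subseteq> W"
      using one subset_add_scalars[of _ h] h(2) unfolding V W_def by (auto simp: dg1)
    ultimately show "X \<in> W" using subW span_minimal by blast
  qed
  moreover have "mat 1 \<notin> span ?V"
  proof -
    have "(mat 1 :: real^'n^'n) \<notin> sl" by (simp add: sl_def trace_mat_1)
    then show ?thesis using h(1) subV unfolding V by (auto simp: span_eq_iff[THEN iffD2])
  qed
  ultimately have "dim W = dim ?V + 1" by (simp add: dim_insert)
  moreover have "card ?T = card {i. Im (lam i) > 0} + card {i. Im (lam i) = 0}"
  proof -
    have "?T = {i. Im (lam i) > 0} \<union> {i. Im (lam i) = 0}" by auto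
    then show ?thesis by (simp only:) (rule card_Un_disjoint; auto)
  qed
  ultimately show ?thesis using dimW by simp
qed

end

section \<open>From a sum of affine algebras to an algebra of polynomials\<close>

text \<open>Placing \<open>z\<close> in component \<open>i\<close> or in component \<open>k\<close>
  gives two decompositions of \<open>z\<close>, which uniqueness identifies.\<close>

lemma lie_direct_sum_Int:
  assumes ds: "lie_direct_sum L br I A" and ik: "i \<in> I" "k \<in> I" "i \<noteq> k"
    and z: "z \<in> A i" "z \<in> A k"
  shows "z = 0"
proof -
  have fin: "finite I" and id: "\<And>i. i \<in> I \<Longrightarrow> lie_ideal (A i) L br"
    using ds by (auto simp: lie_direct_sum_def)
  have zero: "0 \<in> A l" if "l \<in> I" for l
    using id[OF that] by (auto simp: lie_ideal_def subspace_0)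
  define F where "F l = (\<lambda>m\<in>I. if m = l then z else 0)" for l
  have "F l \<in> (\<Pi>\<^sub>E m\<in>I. A m) \<and> z = (\<Sum>m\<in>I. F l m)" if "l = i \<or> l = k" for l
    using that zero z ik fin by (auto simp: F_def)
  moreover have "z \<in> L" using id[OF ik(1)] z(1) by (auto simp: lie_ideal_def)
  then have "\<exists>!f. f \<in> (\<Pi>\<^sub>E m\<in>I. A m) \<and> z = (\<Sum>m\<in>I. f m)"
    using ds by (auto simp: lie_direct_sum_def)
  ultimately have "F i = F k" by blast
  then have "F i i = F k i" by simp
  then show ?thesis using ik by (simp add: F_def)
qed

lemma semidirect_bracket_linear:
  "linear (semidirect_bracket u)" "linear (\<lambda>u. semidirect_bracket u w)"
  by (auto intro!: linearI simp: semidirect_bracket_def vec.add matrix_vector_mult_add_rdistrib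
      algebra_simps scaleR_matrix_vector_assoc matrix_vector_mult_scaleR)

lemma semidirect_bracket_minus: "semidirect_bracket u w = - semidirect_bracket w u"
  by (simp add: semidirect_bracket_def)

text \<open>In the affine algebra [(1, 0), (0, w)] = (0, w), so the image of a translation is a
  bracket and has zero matrix part. Translations thus become vectors \<open>g w\<close>, on which
  the matrix part of the image of (c, 0) acts as multiplication by \<open>c\<close>.\<close>

lemma aff_block:
  fixes A :: "((real^'n^'n) \<times> (real^'n)) set"
  assumes "lie_isomorphic UNIV (aff_bracket :: 'k::real_normed_field \<times> 'k \<Rightarrow> _) A semidirect_bracket"
  shows "\<exists>a x g. linear g \<and> (\<forall>c :: 'k. (a c, x c) \<in> A) \<and> (\<forall>w. (0, g w) \<in> A) \<and>
    (\<forall>c w. a c *v g w = g (c * w)) \<and> g 1 \<noteq> 0 \<and>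
    (\<forall>u\<in>A. \<forall>u'\<in>A. \<exists>w. semidirect_bracket u u' = (0, g w))"
proof -
  obtain f where f: "linear f" "bij_betw f UNIV A"
    "\<And>c d :: 'k \<times> 'k. f (aff_bracket c d) = semidirect_bracket (f c) (f d)"
    using assms by (auto simp: lie_isomorphic_def)
  define a where "a c = fst (f (c, 0))" for c
  define x where "x c = snd (f (c, 0))" for c
  define g where "g w = snd (f (0, w))" for w
  have fA: "f c \<in> A" for c using f(2) by (auto simp: bij_betw_def)
  have br: "semidirect_bracket (f c) (f d) = f (0, fst c * snd d - fst d * snd c)" for c d
    unfolding f(3)[symmetric] by (simp add: aff_bracket_def)
  have "fst (f (0, w)) = 0" for w
    using br[of "(1, 0)" "(0, w)"] by (auto simp: semidirect_bracket_def dest: arg_cong[of _ _ fst])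
  then have fg: "f (0, w) = (0, g w)" for w by (simp add: g_def prod_eq_iff)
  have "linear g"
  proof (rule linearI)
    show "g (v + w) = g v + g w" for v w
      using linear_add[OF f(1), of "(0, v)" "(0, w)"] by (simp add: fg)
    show "g (r *\<^sub>R w) = r *\<^sub>R g w" for r w
      using linear_scale[OF f(1), of r "(0, w)"] by (simp add: fg)
  qed
  moreover have "(a c, x c) \<in> A" for c using fA[of "(c, 0)"] by (simp add: a_def x_def)
  moreover have "(0, g w) \<in> A" for w using fA[of "(0, w)"] by (simp add: fg)
  moreover have "a c *v g w = g (c * w)" for c w
    using br[of "(c, 0)" "(0, w)"] by (simp add: fg semidirect_bracket_def a_def)
  moreover have "g 1 \<noteq> 0"
  proof
    assume "g 1 = 0"
    then have "f (0, 1) = f 0" by (simp add: fg linear_0[OF f(1)] linear_0[OF \<open>linear g\<close>] zero_prod_def)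
    then show False using f(2) by (auto simp: bij_betw_def inj_eq zero_prod_def)
  qed
  moreover have "\<exists>w. semidirect_bracket u u' = (0, g w)" if "u \<in> A" "u' \<in> A" for u u'
    using that f(2) br by (auto simp: bij_betw_def fg)
  ultimately show ?thesis by blast
qed

text \<open>Real blocks are written over the complex numbers as well, with \<open>g\<close> depending on the real part
  only; \<open>j\<close> is then irrelevant.\<close>

definition aff_data :: "((real^'n^'n) \<times> (real^'n)) set \<Rightarrow> bool \<Rightarrow>
    (real^'n^'n) \<times> (real^'n^'n) \<times> (complex \<Rightarrow> real^'n) \<Rightarrow> bool" where
  "aff_data A cplx d \<longleftrightarrow> (case d of (b, j, g) \<Rightarrow> linear g \<and> (\<exists>x. (b, x) \<in> A) \<and> (\<exists>y. (j, y) \<in> A) \<and>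
    (\<forall>w. (0, g w) \<in> A) \<and> (\<forall>w. b *v g w = g w) \<and> g 1 \<noteq> 0 \<and>
    (\<forall>u\<in>A. \<forall>u'\<in>A. \<exists>w. semidirect_bracket u u' = (0, g w)) \<and>
    (if cplx then \<forall>w. j *v g w = g (\<i> * w) else g \<i> = 0))"

lemma aff_complex_data:
  assumes "lie_isomorphic UNIV aff_complex_bracket A semidirect_bracket"
  shows "\<exists>d. aff_data A True d"
proof -
  obtain a x g where *: "linear g" "\<forall>c :: complex. (a c, x c) \<in> A" "\<forall>w. (0, g w) \<in> A"
    "\<forall>c w. a c *v g w = g (c * w)" "g 1 \<noteq> 0"
    "\<forall>u\<in>A. \<forall>u'\<in>A. \<exists>w. semidirect_bracket u u' = (0, g w)"
    using aff_block[OF assms] by blast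
  then have "aff_data A True (a 1, a \<i>, g)" by (auto simp: aff_data_def)
  then show ?thesis by blast
qed

lemma aff_real_data:
  assumes iso: "lie_isomorphic UNIV aff_real_bracket A semidirect_bracket" and "subspace A"
  shows "\<exists>d. aff_data A False d"
proof -
  obtain a x g where *: "linear g" "\<forall>c :: real. (a c, x c) \<in> A" "\<forall>w. (0, g w) \<in> A"
    "\<forall>c w. a c *v g w = g (c * w)" "g 1 \<noteq> 0"
    "\<forall>u\<in>A. \<forall>u'\<in>A. \<exists>w. semidirect_bracket u u' = (0, g w)"
    using aff_block[OF iso] by blast
  have "linear (\<lambda>w. g (Re w))"
    using linear_compose[OF bounded_linear.linear[OF bounded_linear_Re] *(1)] by (simp add: o_def)
  moreover have "(0, 0) \<in> A" using subspace_0[OF assms(2)] by (simp add: zero_prod_def)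
  moreover have "\<exists>w. semidirect_bracket u u' = (0, g (Re w))" if "u \<in> A" "u' \<in> A" for u u'
    using *(6) that by (metis Re_complex_of_real)
  ultimately have "aff_data A False (a 1, 0, \<lambda>w. g (Re w))"
    using * by (auto simp: aff_data_def linear_0)
  then show ?thesis by blast
qed

text \<open>On the image of \<open>g i\<close> the matrix \<open>b i\<close> is the identity and, in
  a complex block, \<open>j i\<close> is a complex structure; the other blocks annihilate it. These
  images span, so a matrix is determined by its action on them. \<open>B\<close> lies in \<real>[M]
  because it centralizes \<open>M\<close>, and conversely every polynomial in \<open>M\<close> acts
  like some \<open>act \<alpha>\<close>.\<close>

lemma sum_of_affs_imp_poly_algebra:
  fixes B :: "(real^'n^'n) set"
  assumes B: "subspace B" "mat 1 \<in> B" and comm: "\<And>X Y. X \<in> B \<Longrightarrow> Y \<in> B \<Longrightarrow> X ** Y = Y ** X"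
    and affs: "is_sum_of_affs (semidirect B) semidirect_bracket p q"
  shows "\<exists>M. nonderogatory M \<and> card (complex_eigenvalues UNIV ((*v) M)) = CARD('n) \<and>
    B = poly_algebra M"
proof -
  let ?I = "{..<p + q}" and ?L = "semidirect B"
  obtain A where ds: "lie_direct_sum ?L semidirect_bracket ?I A"
    and cA: "\<And>i. i < p \<Longrightarrow> lie_isomorphic UNIV aff_complex_bracket (A i) semidirect_bracket"
    and rA: "\<And>i. p \<le> i \<Longrightarrow> i < p + q \<Longrightarrow> lie_isomorphic UNIV aff_real_bracket (A i) semidirect_bracket"
    using affs by (auto simp: is_sum_of_affs_def)
  have id: "lie_ideal (A i) ?L semidirect_bracket" if "i < p + q" for i
    using ds that by (auto simp: lie_direct_sum_def)
  have AL: "A i \<subseteq> ?L" and Asub: "subspace (A i)" if "i < p + q" for i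
    using id[OF that] by (auto simp: lie_ideal_def)
  have "\<exists>d. aff_data (A i) (i < p) d" if "i < p + q" for i
    using that cA[of i] rA[of i] aff_complex_data aff_real_data[OF _ Asub[OF that]]
    by (cases "i < p") auto
  then obtain d where d: "\<And>i. i < p + q \<Longrightarrow> aff_data (A i) (i < p) (d i)" by metis
  define b where "b i = fst (d i)" for i
  define j where "j i = fst (snd (d i))" for i
  define g where "g i = snd (snd (d i))" for i
  have D: "linear (g i)" "\<exists>x. (b i, x) \<in> A i" "\<exists>y. (j i, y) \<in> A i" "(0, g i w) \<in> A i"
    "b i *v g i w = g i w" "g i 1 \<noteq> 0"
    "u \<in> A i \<Longrightarrow> u' \<in> A i \<Longrightarrow> \<exists>w. semidirect_bracket u u' = (0, g i w)"
    "i < p \<Longrightarrow> j i *v g i w = g i (\<i> * w)" "p \<le> i \<Longrightarrow> g i \<i> = 0"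
    if "i < p + q" for i w u u'
    using d[OF that] unfolding aff_data_def b_def j_def g_def by (auto split: prod.splits if_splits)
  have cross: "semidirect_bracket u w = 0" if "i < p + q" "k < p + q" "i \<noteq> k" "u \<in> A i" "w \<in> A k" for i k u w
  proof (rule lie_direct_sum_Int[OF ds])
    show "semidirect_bracket u w \<in> A k"
      using id[OF that(2)] AL[OF that(1)] that by (auto simp: lie_ideal_def)
    have "semidirect_bracket w u \<in> A i"
      using id[OF that(1)] AL[OF that(2)] that by (auto simp: lie_ideal_def)
    then show "semidirect_bracket u w \<in> A i"
      using subspace_neg[OF Asub[OF that(1)]] semidirect_bracket_minus by metis
  qed (use that in auto)
  have cross_g: "X *v g k w = 0" if "i < p + q" "k < p + q" "i \<noteq> k" "(X, x) \<in> A i" for i k X x w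
    using cross[OF that(1-4) D(4)[OF that(2), of w]] by (simp add: semidirect_bracket_def zero_prod_def)
  have inB: "b i \<in> B" "j i \<in> B" if "i < p + q" for i
    using D(2,3)[OF that] AL[OF that] by (auto simp: semidirect_def)
  \<comment> \<open>\<alpha> prescribes a multiplier on each block; on real blocks only real
    multipliers are meaningful.\<close>
  define act where "act \<alpha> = (\<Sum>i\<in>?I. Re (\<alpha> i) *\<^sub>R b i + Im (\<alpha> i) *\<^sub>R j i)" for \<alpha> :: "nat \<Rightarrow> complex"
  have g_expand: "g k w = Re w *\<^sub>R g k 1 + Im w *\<^sub>R g k \<i>" if "k < p + q" for k w
  proof -
    have "g k w = g k (Re w *\<^sub>R 1 + Im w *\<^sub>R \<i>)" by (rule arg_cong[of _ _ "g k"]) (simp add: complex_eq_iff)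
    then show ?thesis by (simp only: linear_add[OF D(1)[OF that]] linear_scale[OF D(1)[OF that]])
  qed
  have act: "act \<alpha> *v g k w = g k (\<alpha> k * w)" if k: "k < p + q" and adm: "\<And>i. p \<le> i \<Longrightarrow> Im (\<alpha> i) = 0" for \<alpha> k w
  proof -
    have "act \<alpha> *v g k w = (\<Sum>i\<in>?I. (Re (\<alpha> i) *\<^sub>R b i + Im (\<alpha> i) *\<^sub>R j i) *v g k w)"
      unfolding act_def by (rule sum_matrix_vector_mult)
    also have "\<dots> = (\<Sum>i\<in>{k}. (Re (\<alpha> i) *\<^sub>R b i + Im (\<alpha> i) *\<^sub>R j i) *v g k w)"
    proof (intro sum.mono_neutral_right ballI)
      fix i assume "i \<in> ?I - {k}"
      then have i: "i < p + q" "i \<noteq> k" by auto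
      have "b i *v g k w = 0" "j i *v g k w = 0"
        using D(2,3)[OF i(1)] cross_g[OF i(1) k i(2)] by blast+
      then show "(Re (\<alpha> i) *\<^sub>R b i + Im (\<alpha> i) *\<^sub>R j i) *v g k w = 0"
        by (simp add: matrix_vector_mult_add_rdistrib flip: scaleR_matrix_vector_assoc)
    qed (use k in auto)
    also have "\<dots> = Re (\<alpha> k) *\<^sub>R g k w + Im (\<alpha> k) *\<^sub>R (j k *v g k w)"
      by (simp add: matrix_vector_mult_add_rdistrib D(5)[OF k] flip: scaleR_matrix_vector_assoc)
    also have "\<dots> = g k (\<alpha> k * w)"
    proof (cases "k < p")
      case True
      have "g k (\<alpha> k * w) = g k (Re (\<alpha> k) *\<^sub>R w + Im (\<alpha> k) *\<^sub>R (\<i> * w))"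
        by (rule arg_cong[of _ _ "g k"]) (simp add: complex_eq_iff)
      then show ?thesis
        by (simp only: linear_add[OF D(1)[OF k]] linear_scale[OF D(1)[OF k]] D(8)[OF k True])
    next
      case False
      then have "Im (\<alpha> k) = 0" by (intro adm) simp
      moreover from this have "g k (\<alpha> k * w) = g k (Re (\<alpha> k) *\<^sub>R w)"
        by (intro arg_cong[of _ _ "g k"]) (simp add: complex_eq_iff)
      ultimately show ?thesis by (simp add: linear_scale[OF D(1)[OF k]])
    qed
    finally show ?thesis .
  qed
  have actB: "act \<alpha> \<in> B" for \<alpha>
    unfolding act_def by (intro subspace_sum subspace_add subspace_scale B inB) auto
  have dec: "\<exists>F. (\<forall>i<p + q. F i \<in> A i) \<and> u = (\<Sum>i\<in>?I. F i)" if u: "u \<in> ?L" for u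
  proof -
    have "\<exists>!F. F \<in> (\<Pi>\<^sub>E i\<in>?I. A i) \<and> u = (\<Sum>i\<in>?I. F i)"
      using ds u by (simp add: lie_direct_sum_def)
    then show ?thesis by (auto simp: PiE_iff)
  qed
  \<comment> \<open>This is where \<open>mat 1 \<in> B\<close> enters: (0, x) is the bracket of (mat
    1, 0) with itself. Decomposing both arguments kills the mixed brackets, and each remaining one
    has the form (0, g i w).\<close>
  have cover: "\<exists>w. x = (\<Sum>i\<in>?I. g i (w i))" for x
  proof -
    have "(mat 1, 0) \<in> ?L" "(0, x) \<in> ?L"
      using B by (auto simp: semidirect_def subspace_0)
    then obtain F G where F: "\<And>i. i < p + q \<Longrightarrow> F i \<in> A i" "(mat 1, 0) = (\<Sum>i\<in>?I. F i)"
      and G: "\<And>i. i < p + q \<Longrightarrow> G i \<in> A i" "(0, x) = (\<Sum>i\<in>?I. G i)"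
      using dec by meson
    have "\<forall>i\<in>?I. \<exists>w. semidirect_bracket (F i) (G i) = (0, g i w)" using D(7) F(1) G(1) by auto
    then obtain w where w: "\<And>i. i < p + q \<Longrightarrow> semidirect_bracket (F i) (G i) = (0, g i (w i))"
      by (metis lessThan_iff)
    have "(0, x) = semidirect_bracket (mat 1, 0) (0, x)" by (simp add: semidirect_bracket_def)
    also have "\<dots> = (\<Sum>i\<in>?I. \<Sum>k\<in>?I. semidirect_bracket (F i) (G k))"
      unfolding F(2) G(2) linear_sum[OF semidirect_bracket_linear(2)]
        linear_sum[OF semidirect_bracket_linear(1)] by (rule sum.swap)
    also have "\<dots> = (\<Sum>i\<in>?I. (0, g i (w i)))"
    proof (rule sum.cong)
      fix i assume i: "i \<in> ?I"
      have "(\<Sum>k\<in>?I. semidirect_bracket (F i) (G k)) = (\<Sum>k\<in>{i}. semidirect_bracket (F i) (G k))"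
      proof (intro sum.mono_neutral_right ballI)
        fix k assume "k \<in> ?I - {i}"
        then show "semidirect_bracket (F i) (G k) = 0" using i by (intro cross[of i k] F G) auto
      qed (use i in auto)
      then show "(\<Sum>k\<in>?I. semidirect_bracket (F i) (G k)) = (0, g i (w i))" using i w by simp
    qed simp
    finally have "snd (0 :: real^'n^'n, x) = snd (\<Sum>i\<in>?I. (0 :: real^'n^'n, g i (w i)))" by (rule arg_cong)
    then have "x = (\<Sum>i\<in>?I. g i (w i))" by (simp add: snd_sum)
    then show ?thesis by blast
  qed
  have eqI: "X = Y" if "\<And>i w. i < p + q \<Longrightarrow> X *v g i w = Y *v g i w" for X Y :: "real^'n^'n"
  proof -
    have "X *v x = Y *v x" for x
    proof -
      obtain w where w: "x = (\<Sum>i\<in>?I. g i (w i))" using cover by blast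
      show ?thesis unfolding w vec.sum by (intro sum.cong refl that) simp
    qed
    then show ?thesis by (simp add: matrix_eq)
  qed
  \<comment> \<open>The real parts \<open>i\<close> keep the blocks apart; the imaginary part 1
    separates a complex multiplier from all conjugates.\<close>
  define \<mu> where "\<mu> i = (if i < p then Complex (real i) 1 else of_nat i)" for i
  define M where "M = act \<mu>"
  have M: "M *v g i w = g i (\<mu> i * w)" if "i < p + q" for i w
    unfolding M_def by (rule act[OF that]) (simp add: \<mu>_def)
  have MB: "M \<in> B" unfolding M_def by (rule actB)
  let ?E = "complex_eigenvalues UNIV ((*v) M)"
  \<comment> \<open>The complex eigenvectors have real part \<open>g i 1\<close> and imaginary part
    \<open>- g i \<i>\<close> for \<mu>, or \<open>g i \<i>\<close> for its conjugate. In a real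
    block \<open>g i \<i>\<close> is 0 and both cases coincide.\<close>
  have E: "\<mu> i \<in> ?E" "cnj (\<mu> i) \<in> ?E" if i: "i < p + q" for i
  proof -
    have neg: "M *v (- x) = - (M *v x)" for x by (rule vec.neg)
    have "M *v g i 1 = Re (\<mu> i) *\<^sub>R g i 1 + Im (\<mu> i) *\<^sub>R g i \<i>"
      "M *v g i \<i> = Re (\<mu> i) *\<^sub>R g i \<i> - Im (\<mu> i) *\<^sub>R g i 1"
      unfolding M[OF i] by (simp_all add: g_expand[OF i, of "\<mu> i"] g_expand[OF i, of "\<mu> i * \<i>"])
    then show "\<mu> i \<in> ?E" "cnj (\<mu> i) \<in> ?E"
      using D(6)[OF i]
      by (auto intro: complex_eigenvaluesI[of "g i 1" _ _ "- g i \<i>"]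
          complex_eigenvaluesI[of "g i 1" _ _ "g i \<i>"] simp: neg)
  qed
  define S where "S = \<mu> ` ?I \<union> (cnj \<circ> \<mu>) ` {..<p}"
  have inj: "inj \<mu>"
  proof (rule injI)
    fix i k assume "\<mu> i = \<mu> k"
    then have "Re (\<mu> i) = Re (\<mu> k)" by simp
    then show "i = k" by (simp add: \<mu>_def split: if_splits)
  qed
  have "card S = card (\<mu> ` ?I) + card ((cnj \<circ> \<mu>) ` {..<p})"
    unfolding S_def
  proof (rule card_Un_disjoint)
    have "\<mu> i \<noteq> cnj (\<mu> k)" if "k < p" for i k
      using that by (auto simp: \<mu>_def complex_eq_iff)
    then show "\<mu> ` ?I \<inter> (cnj \<circ> \<mu>) ` {..<p} = {}" by (force simp: disjoint_iff)
  qed auto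
  moreover have "inj (cnj \<circ> \<mu>)" using inj by (simp add: inj_def)
  ultimately have cardS: "card S = (p + q) + p"
    using inj card_image[of \<mu> ?I] card_image[of "cnj \<circ> \<mu>" "{..<p}"]
    by (metis card_lessThan inj_on_subset subset_UNIV)
  \<comment> \<open>Each complex block needs two spanning vectors, \<open>g i 1\<close> and
    \<open>g i \<i>\<close>, and each real block only the first.\<close>
  have "CARD('n) \<le> (p + q) + p"
  proof -
    let ?G = "(\<lambda>i. g i 1) ` ?I \<union> (\<lambda>i. g i \<i>) ` {..<p}"
    have "x \<in> span ?G" for x
    proof -
      obtain w where w: "x = (\<Sum>i\<in>?I. g i (w i))" using cover by blast
      have "g i (w i) \<in> span ?G" if i: "i \<in> ?I" for i
      proof -
        have "g i \<i> \<in> span ?G"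
          using i D(9)[of i] by (cases "i < p") (auto intro: span_base span_zero)
        moreover have "g i 1 \<in> span ?G" using i by (intro span_base) auto
        ultimately show ?thesis
          using i by (subst g_expand) (auto intro: span_add span_scale)
      qed
      then show ?thesis unfolding w by (rule span_sum)
    qed
    then have "dim (UNIV :: (real^'n) set) \<le> card ?G" by (intro dim_le_card) auto
    also have "\<dots> \<le> card ((\<lambda>i. g i 1) ` ?I) + card ((\<lambda>i. g i \<i>) ` {..<p})" by (rule card_Un_le)
    also have "\<dots> \<le> card ?I + card {..<p}" by (intro add_mono card_image_le) auto
    finally show ?thesis by simp
  qed
  moreover have "finite ?E \<and> card ?E \<le> CARD('n)"
    by (rule card_eigenvalues_le) (auto simp: complex_eigenvalues_iff)
  moreover have "S \<subseteq> ?E" using E by (auto simp: S_def)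
  ultimately have card: "card ?E = CARD('n)"
    using cardS card_mono[of ?E S] by auto
  obtain lam v sg Q where "eigenbasis M lam v sg Q" using eigenbasis_exists[OF card] by blast
  then interpret eigenbasis M lam v sg Q .
  have "X \<in> poly_algebra M" if "X \<in> B" for X
    using comm[OF that MB] by (simp add: centralizer_eq_poly_algebra)
  moreover have "mat_poly r M \<in> B" for r
  proof -
    \<comment> \<open>The multipliers follow Horner's recursion, and those of real blocks stay real
      because \<mu> is real there.\<close>
    have "\<exists>\<alpha>. (\<forall>i\<ge>p. Im (\<alpha> i) = 0) \<and> (\<forall>i<p + q. \<forall>w. mat_poly r M *v g i w = g i (\<alpha> i * w))"
    proof (induction r)
      case 0
      show ?case by (rule exI[of _ "\<lambda>_. 0"]) (simp add: linear_0[OF D(1)])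
    next
      case (pCons a r)
      then obtain \<alpha> where \<alpha>: "\<forall>i\<ge>p. Im (\<alpha> i) = 0"
        "\<forall>i<p + q. \<forall>w. mat_poly r M *v g i w = g i (\<alpha> i * w)" by blast
      have "mat_poly (pCons a r) M *v g i w = g i ((a + \<mu> i * \<alpha> i) * w)" if i: "i < p + q" for i w
      proof -
        have "mat_poly (pCons a r) M *v g i w = a *\<^sub>R g i w + g i (\<mu> i * (\<alpha> i * w))"
          using \<alpha>(2) i by (simp add: mat_poly_pCons matrix_vector_mult_add_rdistrib M
              flip: matrix_vector_mul_assoc scaleR_matrix_vector_assoc)
        also have "\<dots> = g i (a *\<^sub>R w + \<mu> i * (\<alpha> i * w))"
          by (simp only: linear_add[OF D(1)[OF i]] linear_scale[OF D(1)[OF i]])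
        finally show ?thesis by (simp add: algebra_simps scaleR_conv_of_real)
      qed
      moreover have "Im (a + \<mu> i * \<alpha> i) = 0" if "p \<le> i" for i using \<alpha>(1) that by (simp add: \<mu>_def)
      ultimately show ?case by (intro exI[of _ "\<lambda>i. a + \<mu> i * \<alpha> i"]) blast
    qed
    then obtain \<alpha> where \<alpha>: "\<And>i. p \<le> i \<Longrightarrow> Im (\<alpha> i) = 0"
      "\<And>i w. i < p + q \<Longrightarrow> mat_poly r M *v g i w = g i (\<alpha> i * w)" by blast
    have "mat_poly r M = act \<alpha>" by (rule eqI) (simp add: \<alpha>(2) act \<alpha>(1))
    then show ?thesis using actB by simp
  qed
  ultimately have "B = poly_algebra M" by (auto simp: poly_algebra_def)
  then show ?thesis using nonderogatory card by blast
qed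

text \<open>The relation between \<open>p\<close>, \<open>q\<close> and the vector part in (c) is
  the one from \<open>dim_vector_part\<close>. The diagonal subalgebra of sl(2, \<real>) shows that
  \<open>q\<close> itself is not the dimension of the vector part: there are two real blocks, while
  the vector part is a line.\<close>

theorem theorem6p2:
  fixes h :: "(real^'n^'n) set"
  assumes "lie_subalgebra h sl mat_bracket" and "lie_abelian h mat_bracket"
  shows "(cartan_subalgebra h sl mat_bracket \<longleftrightarrow>
           (\<exists>M. nonderogatory M \<and> card (complex_eigenvalues UNIV ((*v) M)) = CARD('n) \<and>
                add_scalars h = poly_algebra M)) \<and>
         ((\<exists>M. nonderogatory M \<and> card (complex_eigenvalues UNIV ((*v) M)) = CARD('n) \<and>
                add_scalars h = poly_algebra M) \<longleftrightarrow>
           (\<exists>p q. p = dim (toroidal_part h sl mat_bracket) \<and>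
                  p + q = dim (vector_part h sl mat_bracket) + 1 \<and>
                  is_sum_of_affs (semidirect (add_scalars h)) semidirect_bracket p q))"
    (is "(?a \<longleftrightarrow> ?b) \<and> (_ \<longleftrightarrow> ?c)")
proof -
  have h: "subspace h" "h \<subseteq> sl" using assms(1) by (auto simp: lie_subalgebra_def)
  have "?a \<Longrightarrow> ?b" by (rule cartan_imp_poly_algebra[OF _ assms(2)])
  \<comment> \<open>Both (a) and (c) are read off the eigenbasis of the matrix that (b)
    provides.\<close>
  moreover have "?a \<and> ?c" if ?b
  proof -
    obtain M where M: "card (complex_eigenvalues UNIV ((*v) M)) = CARD('n)"
      "add_scalars h = poly_algebra M" using \<open>?b\<close> by blast
    obtain lam v sg Q where "eigenbasis M lam v sg Q" using eigenbasis_exists[OF M(1)] by blast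
    then interpret eigenbasis M lam v sg Q .
    have ?a by (rule poly_algebra_imp_cartan[OF assms M(2)])
    moreover have ?c
      using dim_toroidal_part[OF h(2) M(2) h(1)] dim_vector_part[OF h(2) M(2) h(1)]
        is_sum_of_affs_poly_algebra M(2) by metis
    ultimately show ?thesis ..
  qed
  moreover have ?b if ?c
  proof -
    have "X ** Y = Y ** X" if "X \<in> add_scalars h" "Y \<in> add_scalars h" for X Y
      using add_scalars_abelian[OF assms(2) that] by (simp add: mat_bracket_def)
    then show ?thesis
      using sum_of_affs_imp_poly_algebra[OF subspace_add_scalars[OF h(1)] one_in_add_scalars[OF h(1)]]
        \<open>?c\<close> by blast
  qed
  ultimately show ?thesis by blast
qed

end
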